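(* (i) For every $s\in\mathbb{C}$ with $\mathrm{Re}(s)>0$ and every ${\bf k}=(k_1,k_2,\dots)\in\widehat{\mathcal T}$ the limit $$\mathfrak{h}_s({\bf k})=\lim_{r\to+\infty}H_s^\star(k_1,\dots,k_r)$$ exists in $\mathbb{C}$; thus $\mathfrak{h}_s:\widehat{\mathcal T}\to\mathbb{C}$ is a well-defined map. (ii) For every real $s>1$, the map $\mathfrak{h}_s$ is a bijection from $\widehat{\mathcal T}$ onto the interval $(1,s]$. (iii) With $|\mathrm{Im}(s)|$ kept bounded, $\lim_{\mathrm{Re}(s)\to+\infty}\mathfrak{h}_s\big|_{\mathcal T}=\eta$. That is, for every ${\bf k}\in\mathcal T$ and every $B>0$, $\mathfrak{h}_s({\bf k})\to\eta({\bf k})$ as $\mathrm{Re}(s)\to+\infty$ subject to $|\mathrm{Im}(s)|\le B$.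
   Context: $\mathbb{Z}^+=\{1,2,\dots\}$ and $\widehat{\mathcal T}=(\mathbb{Z}^+)^\infty$ is the set of all infinite sequences of positive integers. $H_s^\star$: for $M\in\mathbb{Z}^+$ let $H_M^\star(k_1,\dots,k_r)=\sum_{M\ge m_1\ge\cdots\ge m_r\ge1}\frac{1}{m_1^{k_1}\cdots m_r^{k_r}}$, and for $\mathrm{Re}(s)>0$ let $G_M^\star(s;k_1,\dots,k_r)=\sum_{M\ge m_1\ge\cdots\ge m_r\ge1}\frac{1}{(m_1+s)^{k_1}\cdots(m_r+s)^{k_r}}$. For complex $s$ with $\mathrm{Re}(s)>0$ define $H_s^\star(\varnothing)=1$ and inductively, for $r\ge1$ and $(k_1,\dots,k_r)\in(\mathbb{Z}^+)^r$, $$H_s^\star(k_1,\dots,k_r)=\lim_{M\to+\infty}\Big(H_M^\star(k_1,\dots,k_r)-\sum_{j=1}^rG_M^\star(s;k_1,\dots,k_j)\,H_s^\star(k_{j+1},\dots,k_r)\Big),$$ $M$ running over positive integers (these limits exist, and for $s=n\in\mathbb{Z}^+$ the value is the finite sum $H_n^\star(k_1,\dots,k_r)$). $\mathcal T$ is the set of $(k_1,k_2,\dots)\in\widehat{\mathcal T}$ such that $k_1\ge2$ and, if $k_1=2$, then $k_i\ge2$ for some $i\ge2$. For $k_1\ge2$, $k_2,\dots,k_r\ge1$, $\zeta^\star(k_1,\dots,k_r)=\sum_{n_1\ge\cdots\ge n_r\ge1}\frac{1}{n_1^{k_1}\cdots n_r^{k_r}}$. The map $\eta:\mathcal T\to(1,+\infty)$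 is $\eta({\bf k})=\lim_{r\to+\infty}\zeta^\star(k_1,\dots,k_r)$ (this limit is known to exist and be finite for ${\bf k}\in\mathcal T$). *)

theory Defs
  imports "HOL-Analysis.Analysis"
begin

definition noninc_tuples :: "nat \<Rightarrow> nat list set" where
  "noninc_tuples r = {ms. length ms = r \<and> sorted_wrt (\<ge>) ms \<and> (\<forall>m\<in>set ms. 1 \<le> m)}"

definition H_fin :: "nat \<Rightarrow> nat list \<Rightarrow> complex" where
  "H_fin M ks =
     (\<Sum>ms | ms \<in> noninc_tuples (length ks) \<and> (\<forall>m\<in>set ms. m \<le> M).
        1 / (\<Prod>i<length ks. of_nat (ms ! i) ^ (ks ! i)))"

definition G_fin :: "nat \<Rightarrow> complex \<Rightarrow> nat list \<Rightarrow> complex" where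
  "G_fin M s ks =
     (\<Sum>ms | ms \<in> noninc_tuples (length ks) \<and> (\<forall>m\<in>set ms. m \<le> M).
        1 / (\<Prod>i<length ks. (of_nat (ms ! i) + s) ^ (ks ! i)))"

function H_star :: "complex \<Rightarrow> nat list \<Rightarrow> complex" where
  "H_star s [] = 1"
| "H_star s (k # ks) =
     lim (\<lambda>M. H_fin M (k # ks) -
       (\<Sum>j\<in>{1..length (k # ks)}. G_fin M s (take j (k # ks)) * H_star s (drop j (k # ks))))"
  by pat_completeness auto
termination
  by (relation "Wellfounded.measure (\<lambda>(s, ks). length ks)") auto

definition zeta_star :: "nat list \<Rightarrow> real" where
  "zeta_star ks =
     (\<Sum>\<^sub>\<infinity>ns\<in>noninc_tuples (length ks). 1 / (\<Prod>i<length ks. of_nat (ns ! i) ^ (ks ! i)))"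

(* Sequences are indexed from 0: the value k i is the entry k_(i+1) of (k_1, k_2, ...),
   so that map k [0..<r] is (k_1, ..., k_r). *)

definition T_hat :: "(nat \<Rightarrow> nat) set" where
  "T_hat = {k. \<forall>i. k i \<ge> 1}"

definition T_set :: "(nat \<Rightarrow> nat) set" where
  "T_set = {k \<in> T_hat. k 0 \<ge> 2 \<and> (k 0 = 2 \<longrightarrow> (\<exists>i\<ge>1. k i \<ge> 2))}"

definition frak_h :: "complex \<Rightarrow> (nat \<Rightarrow> nat) \<Rightarrow> complex" where
  "frak_h s k = lim (\<lambda>r. H_star s (map k [0..<r]))"

definition eta_map :: "(nat \<Rightarrow> nat) \<Rightarrow> real" where
  "eta_map k = lim (\<lambda>r. zeta_star (map k [0..<r]))"

end

theory Submission
  imports Defs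
begin

text \<open>
  The sums are governed by one averaging operator. For x in [0,1] put
  e_x(s) = (1 - x^s) / (1 - x), with e_1(s) = s; at an integer s = n this is the geometric sum
  1 + x + ... + x^(n-1). In the basis e_x, the passage from f(s) to the sum over m \<le> s of
  f(m) / m^k is averaging in the parameter: e_x(m) / m is the mean of y^(m-1) for y on the segment
  from x to 1, and each further factor 1/m replaces y^(m-1) by the mean of z^(m-1) for z on the
  segment from 0 to y. Hence an exponent k acts on functions of x as k - 1 averages towards 0
  and one average towards 1, and H*_s(k_1,...,k_r) is the value at x = 0 of the function e_x(s)
  after the averages prescribed by k_1, ..., k_r have been applied in this order.

  To identify this expression (H_avg) with the limit that defines H*_s, one checks
  that it satisfies the difference equation
  H_{s+1}(k_1,...,k_r) - H_s(k_1,...,k_r) = (s+1)^{-k_1} H_{s+1}(k_2,...,k_r). Iterating it produces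
  precisely the sums G*_M, and starting from s = 1 it gives the finite sums at the integers
  (H_avg_telescope, H_avg_nat). What remains is H_{s+M} - H_M \<rightarrow> 0, which follows because
  x^M (1-x)^{1/2} is uniformly small and the weight (1-x)^{-1/2} is at most doubled by each average.

  Existence of the limit: an average towards an endpoint halves distances, so the oscillation on
  [0,1] of the averaged functions tends to 0 (fold_seg_avg_oscillation), while their values stay in
  the closed convex hull of the preceding ones. The limit is the constant to which they collapse.

  Bijectivity: for real s > 1 the function e_x(s) increases strictly from 1 to s, and averages
  preserve strict monotonicity. If g is the function reached after a prefix, then the next exponents
  k = 1, 2, 3, ... cut the interval (g(0), g(1)] into the disjoint half-open intervals
  (c_k, c_{k-1}], where c_k is the value at 1 of the k-fold average of g towards 0. This is a digit
  expansion whose nested intervals shrink to a point (bij_betw_limit_value).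

  Comparison with eta: the difference of e_x(s) and e_x(t) is at most 2 x^\<sigma> / (1-x) when
  Re s, Re t \<ge> \<sigma>. This is O(\<sigma>^{-1/4} (1-x)^{-5/4}); one average towards 0 reduces the singularity to
  (1-x)^{-1/2}, averages towards 1 preserve this order, and a second average towards 0 makes the
  function bounded. The condition defining the set T says exactly that two averages towards 0
  occur, the very first one being one of them. So H*_s and H*_t differ by O(\<sigma>^{-1/4}) uniformly in
  the length of the tuple, and letting t run through the integers replaces H*_t by zeta*.
\<close>

section \<open>Averages over segments\<close>

definition seg_avg :: "real \<Rightarrow> (real \<Rightarrow> 'a::banach) \<Rightarrow> real \<Rightarrow> 'a" where
  "seg_avg c g x = integral {0..1} (\<lambda>u. g (c + u * (x - c)))"

lemma segment_in_unit:
  fixes c x u :: real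
  assumes "c \<in> {0..1}" "x \<in> {0..1}" "u \<in> {0..1}"
  shows "c + u * (x - c) \<in> {0..1}"
proof -
  have "c + u * (x - c) = (1 - u) * c + u * x" by (simp add: algebra_simps)
  moreover have "0 \<le> (1 - u) * c + u * x" using assms by simp
  moreover have "(1 - u) * c + u * x \<le> 1"
    using assms by (intro convex_bound_le) auto
  ultimately show ?thesis by simp
qed

lemma continuous_on_segment:
  assumes "continuous_on {0..1} g" "c \<in> {0..1}" "x \<in> {0..1::real}"
  shows "continuous_on {0..1} (\<lambda>u. g (c + u * (x - c)))"
  by (rule continuous_on_compose2[OF assms(1)])
     (use segment_in_unit[OF assms(2,3)] in \<open>auto intro!: continuous_intros\<close>)

lemma integrable_on_segment:
  fixes g :: "real \<Rightarrow> 'a::banach"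
  assumes "continuous_on {0..1} g" "c \<in> {0..1}" "x \<in> {0..1::real}"
  shows "(\<lambda>u. g (c + u * (x - c))) integrable_on {0..1}"
  by (rule integrable_continuous_interval[OF continuous_on_segment[OF assms]])

lemma continuous_on_seg_avg:
  fixes g :: "real \<Rightarrow> 'a::banach"
  assumes "continuous_on {0..1} g" "c \<in> {0..1}"
  shows "continuous_on {0..1} (seg_avg c g)"
proof -
  have "continuous_on ({0..1} \<times> cbox 0 1) (\<lambda>(x, u). g (c + u * (x - c)))"
    unfolding split_beta
    by (rule continuous_on_compose2[OF assms(1)])
       (use segment_in_unit[OF assms(2)] in \<open>auto intro!: continuous_intros\<close>)
  from integral_continuous_on_param[OF this] show ?thesis
    by (simp add: seg_avg_def[abs_def])
qed

lemma seg_avg_const [simp]: "seg_avg c (\<lambda>_. a) x = a"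
  by (simp add: seg_avg_def)

lemma seg_avg_base [simp]: "seg_avg c g c = g c"
  by (simp add: seg_avg_def)

lemma seg_avg_opposite_endpoints:
  fixes g :: "real \<Rightarrow> 'a::euclidean_space"
  shows "seg_avg 1 g 0 = seg_avg 0 g 1"
proof -
  have "integral {0..1} (\<lambda>u. g (1 + - u)) = integral {-1..0} (\<lambda>u. g (1 + u))"
    using Henstock_Kurzweil_Integration.integral_reflect_real[of 0 "-1" "\<lambda>u. g (1 + u)"]
    by simp
  also have "\<dots> = integral {-1..0} (\<lambda>u. g (u + 1))"
    by (simp add: add.commute)
  also have "\<dots> = integral {0..1} g"
    using integral_shift_real_ivl[of 0 1 1 g] by simp
  finally show ?thesis by (simp add: seg_avg_def)
qed

text \<open>
  Two linear maps are allowed at once so that sums, differences, scalar multiples, the embedding of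
  the reals into the complex numbers and agreement on [0,1] are all instances.
\<close>

lemma seg_avg_linear:
  fixes f :: "real \<Rightarrow> 'a::banach" and g :: "real \<Rightarrow> 'b::banach" and h :: "real \<Rightarrow> 'c::banach"
  assumes L: "bounded_linear L" "bounded_linear M"
    and fg: "continuous_on {0..1} f" "continuous_on {0..1} g"
    and h: "\<And>x. x \<in> {0..1} \<Longrightarrow> h x = L (f x) + M (g x)"
    and c: "c \<in> {0..1}" "x \<in> {0..1}"
  shows "seg_avg c h x = L (seg_avg c f x) + M (seg_avg c g x)"
proof -
  note i = integrable_on_segment[OF fg(1) c] integrable_on_segment[OF fg(2) c]
  have "seg_avg c h x = integral {0..1} (\<lambda>u. L (f (c + u * (x - c))) + M (g (c + u * (x - c))))"
    unfolding seg_avg_def by (rule integral_cong) (use segment_in_unit[OF c] h in auto)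
  also have "\<dots> = integral {0..1} (\<lambda>u. L (f (c + u * (x - c))))
      + integral {0..1} (\<lambda>u. M (g (c + u * (x - c))))"
    by (rule integral_add)
       (use integrable_linear[OF i(1) L(1)] integrable_linear[OF i(2) L(2)] in \<open>auto simp: o_def\<close>)
  also have "\<dots> = L (seg_avg c f x) + M (seg_avg c g x)"
    using integral_linear[OF i(1) L(1)] integral_linear[OF i(2) L(2)]
    by (simp add: o_def seg_avg_def)
  finally show ?thesis .
qed

text \<open>
  The majorant is only required on the open interval: it will be an integrable power of \<open>u\<close> or
  \<open>1 - u\<close>, which takes the junk value 0 at its singular endpoint.
\<close>

lemma norm_seg_avg_le:
  fixes g :: "real \<Rightarrow> 'a::banach"
  assumes g: "continuous_on {0..1} g" and c: "c \<in> {0..1}" "x \<in> {0..1}"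
    and b: "(b has_integral I) {0..1}"
    and le: "\<And>u. 0 < u \<Longrightarrow> u < 1 \<Longrightarrow> norm (g (c + u * (x - c))) \<le> b u"
  shows "norm (seg_avg c g x) \<le> I"
proof -
  have "norm (integral {0<..<1} (\<lambda>u. g (c + u * (x - c)))) \<le> integral {0<..<1} b"
    by (rule integral_norm_bound_integral)
       (use integrable_on_segment[OF g c] b le in
         \<open>auto simp: integrable_on_open_interval_real intro: has_integral_integrable\<close>)
  thus ?thesis
    using b integral_unique[OF b] by (simp add: seg_avg_def integral_open_interval_real)
qed

lemma fold_seg_avg_linear:
  fixes f :: "real \<Rightarrow> 'a::banach" and g :: "real \<Rightarrow> 'b::banach" and h :: "real \<Rightarrow> 'c::banach"
  assumes L: "bounded_linear L" "bounded_linear M"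
    and "continuous_on {0..1} f" "continuous_on {0..1} g"
    and "\<And>x. x \<in> {0..1} \<Longrightarrow> h x = L (f x) + M (g x)"
    and "set cs \<subseteq> {0..1}" "x \<in> {0..1}"
  shows "fold seg_avg cs h x = L (fold seg_avg cs f x) + M (fold seg_avg cs g x)"
  using assms(3-)
proof (induction cs arbitrary: f g h)
  case (Cons c cs)
  have c: "c \<in> {0..1}" using Cons.prems(4) by simp
  have "fold seg_avg cs (seg_avg c h) x
      = L (fold seg_avg cs (seg_avg c f) x) + M (fold seg_avg cs (seg_avg c g) x)"
    by (rule Cons.IH)
       (use Cons.prems c in \<open>auto intro!: continuous_on_seg_avg seg_avg_linear[OF L]\<close>)
  then show ?case by simp
qed simp

lemma continuous_on_fold_seg_avg:
  fixes g :: "real \<Rightarrow> 'a::banach"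
  assumes "continuous_on {0..1} g" "set cs \<subseteq> {0..1}"
  shows "continuous_on {0..1} (fold seg_avg cs g)"
  using assms
proof (induction cs arbitrary: g)
  case (Cons c cs)
  then show ?case using continuous_on_seg_avg[of g c] by simp
qed simp

lemma fold_seg_avg_const [simp]: "fold seg_avg cs (\<lambda>_. a) = (\<lambda>_. a)"
proof -
  have "seg_avg c (\<lambda>_. a) = (\<lambda>_. a)" for c by (rule ext) simp
  thus ?thesis by (induction cs) auto
qed

lemma fold_seg_avg_diff:
  fixes f g :: "real \<Rightarrow> 'a::banach"
  assumes "continuous_on {0..1} f" "continuous_on {0..1} g" "set cs \<subseteq> {0..1}" "x \<in> {0..1}"
  shows "fold seg_avg cs (\<lambda>x. f x - g x) x = fold seg_avg cs f x - fold seg_avg cs g x"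
  using fold_seg_avg_linear[OF bounded_linear_ident bounded_linear_minus[OF bounded_linear_ident]
      assms(1,2) _ assms(3,4), of "\<lambda>x. f x - g x"] by simp

lemma norm_fold_seg_avg_le:
  fixes g :: "real \<Rightarrow> 'a::banach"
  assumes "continuous_on {0..1} g" "\<And>x. x \<in> {0..1} \<Longrightarrow> norm (g x) \<le> B"
    and "set cs \<subseteq> {0..1}" "x \<in> {0..1}"
  shows "norm (fold seg_avg cs g x) \<le> B"
  using assms
proof (induction cs arbitrary: g)
  case (Cons c cs)
  have c: "c \<in> {0..1}" using Cons.prems(3) by simp
  have "norm (fold seg_avg cs (seg_avg c g) x) \<le> B"
  proof (rule Cons.IH)
    fix y :: real assume y: "y \<in> {0..1}"
    have "((\<lambda>_. B) has_integral B) {0..1::real}"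
      using has_integral_const_real[of B 0 1] by simp
    from norm_seg_avg_le[OF Cons.prems(1) c y this]
    show "norm (seg_avg c g y) \<le> B"
      using Cons.prems(2) segment_in_unit[OF c y] by auto
  qed (use Cons.prems c in \<open>auto intro!: continuous_on_seg_avg\<close>)
  then show ?case by simp
qed simp

text \<open>
  The points at parameter \<open>u\<close> of the segments from \<open>c\<close> to \<open>x\<close> and from \<open>c\<close> to \<open>y\<close> are at distance
  \<open>u * \<bar>x - y\<bar>\<close>, and \<open>u\<close> has mean 1/2. The additive error \<open>e\<close> is what lets the estimate apply
  to functions that are merely continuous, such as \<open>x powr s\<close> near 0 when \<open>Re s < 1\<close>.
\<close>

lemma fold_seg_avg_contraction:
  fixes g :: "real \<Rightarrow> 'a::banach"
  assumes "continuous_on {0..1} g"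
    and "\<And>x y. x \<in> {0..1} \<Longrightarrow> y \<in> {0..1} \<Longrightarrow> norm (g x - g y) \<le> e + C * \<bar>x - y\<bar>"
    and "set cs \<subseteq> {0..1}" "x \<in> {0..1}" "y \<in> {0..1}"
  shows "norm (fold seg_avg cs g x - fold seg_avg cs g y) \<le> e + C / 2 ^ length cs * \<bar>x - y\<bar>"
  using assms
proof (induction cs arbitrary: g C)
  case (Cons c cs)
  have c: "c \<in> {0..1}" using Cons.prems(3) by simp
  have "norm (fold seg_avg cs (seg_avg c g) x - fold seg_avg cs (seg_avg c g) y)
      \<le> e + (C / 2) / 2 ^ length cs * \<bar>x - y\<bar>"
  proof (rule Cons.IH)
    fix x y :: real assume xy: "x \<in> {0..1}" "y \<in> {0..1}"
    have i: "((\<lambda>u. u) has_integral (1/2)) {0..1::real}"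
      using ident_has_integral[of 0 1] by simp
    have j: "((\<lambda>_. e) has_integral e) {0..1::real}"
      using has_integral_const_real[of e 0 1] by simp
    have "((\<lambda>u. e + C * \<bar>x - y\<bar> * u) has_integral e + C * \<bar>x - y\<bar> * (1/2)) {0..1}"
      by (intro has_integral_add j has_integral_mult_right i)
    moreover have "norm (g (c + u * (x - c)) - g (c + u * (y - c))) \<le> e + C * \<bar>x - y\<bar> * u"
      if u: "u \<in> {0..1}" for u
    proof -
      have "(c + u * (x - c)) - (c + u * (y - c)) = u * (x - y)"
        by (simp add: algebra_simps)
      hence "\<bar>(c + u * (x - c)) - (c + u * (y - c))\<bar> = u * \<bar>x - y\<bar>"
        using u by (simp add: abs_mult)
      with Cons.prems(2)[OF segment_in_unit[OF c xy(1) u] segment_in_unit[OF c xy(2) u]]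
      show ?thesis by (simp add: mult_ac)
    qed
    ultimately have "norm (integral {0..1} (\<lambda>u. g (c + u * (x - c)) - g (c + u * (y - c))))
        \<le> e + C * \<bar>x - y\<bar> * (1/2)"
      using integral_norm_bound_integral[of "\<lambda>u. g (c + u * (x - c)) - g (c + u * (y - c))" "{0..1}"
          "\<lambda>u. e + C * \<bar>x - y\<bar> * u"]
        integrable_on_segment[OF Cons.prems(1) c] xy
      by (auto simp: integrable_diff integral_unique has_integral_integrable)
    thus "norm (seg_avg c g x - seg_avg c g y) \<le> e + C / 2 * \<bar>x - y\<bar>"
      using integrable_on_segment[OF Cons.prems(1) c] xy
      by (simp add: seg_avg_def integral_diff)
  qed (use Cons.prems c in \<open>auto intro!: continuous_on_seg_avg\<close>)
  then show ?case by (simp add: field_simps)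
qed simp

lemma fold_seg_avg_oscillation:
  fixes g :: "real \<Rightarrow> 'a::banach"
  assumes g: "continuous_on {0..1} g" and e: "e > 0"
  obtains N where "\<And>cs x y. set cs \<subseteq> {0..1} \<Longrightarrow> N \<le> length cs \<Longrightarrow> x \<in> {0..1} \<Longrightarrow> y \<in> {0..1} \<Longrightarrow>
      norm (fold seg_avg cs g x - fold seg_avg cs g y) < e"
proof -
  have "uniformly_continuous_on {0..1} g"
    by (rule compact_uniformly_continuous[OF g]) simp
  then obtain d where d: "d > 0" and
    dd: "\<And>x y. x \<in> {0..1} \<Longrightarrow> y \<in> {0..1} \<Longrightarrow> dist y x < d \<Longrightarrow> dist (g y) (g x) < e / 2"
    unfolding uniformly_continuous_on_def using e half_gt_zero by metis
  have "bounded (g ` {0..1})"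
    by (intro compact_imp_bounded compact_continuous_image g) simp
  then obtain B where B: "\<And>x. x \<in> {0..1} \<Longrightarrow> norm (g x) \<le> B"
    unfolding bounded_iff by blast
  have B0: "B \<ge> 0" using order_trans[OF norm_ge_zero B[of 0]] by simp
  define C where "C = 2 * B / d"
  have C0: "C \<ge> 0" using B0 d by (simp add: C_def)
  \<comment> \<open>close points differ by at most e/2 by uniform continuity, distant ones by C d = 2 B\<close>
  have lip: "norm (g x - g y) \<le> e / 2 + C * \<bar>x - y\<bar>" if "x \<in> {0..1}" "y \<in> {0..1}" for x y
  proof (cases "\<bar>x - y\<bar> < d")
    case True
    with dd[OF that(2,1)] have "norm (g x - g y) < e / 2" by (simp add: dist_norm)
    moreover have "0 \<le> C * \<bar>x - y\<bar>" using C0 by simp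
    ultimately show ?thesis by simp
  next
    case False
    have "norm (g x - g y) \<le> B + B"
      using norm_triangle_ineq4[of "g x" "g y"] B[OF that(1)] B[OF that(2)] by linarith
    also have "B + B = C * d" using d by (simp add: C_def)
    also have "C * d \<le> C * \<bar>x - y\<bar>" using False C0 by (intro mult_left_mono) auto
    finally show ?thesis using e by simp
  qed
  have "(\<lambda>n. C * (1/2) ^ n) \<longlonglongrightarrow> C * 0"
    by (intro tendsto_mult tendsto_const LIMSEQ_power_zero) simp
  then have "eventually (\<lambda>n. C * (1/2) ^ n < e / 2) sequentially"
    using e by (intro order_tendstoD(2)) auto
  then obtain N where N: "\<And>n. n \<ge> N \<Longrightarrow> C * (1/2) ^ n < e / 2"
    by (auto simp: eventually_sequentially)
  show ?thesis
  proof
    fix cs :: "real list" and x y :: real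
    assume cs: "set cs \<subseteq> {0..1}" "N \<le> length cs" and xy: "x \<in> {0..1}" "y \<in> {0..1}"
    have "norm (fold seg_avg cs g x - fold seg_avg cs g y)
        \<le> e / 2 + C / 2 ^ length cs * \<bar>x - y\<bar>"
      by (rule fold_seg_avg_contraction[OF g lip cs(1) xy])
    also have "\<dots> \<le> e / 2 + C / 2 ^ length cs * 1"
      using xy C0 by (intro add_left_mono mult_left_mono) auto
    also have "\<dots> < e"
    proof -
      have "C / 2 ^ length cs = C * (1/2) ^ length cs" by (simp add: power_one_over)
      with N[OF cs(2)] show ?thesis by linarith
    qed
    finally show "norm (fold seg_avg cs g x - fold seg_avg cs g y) < e" .
  qed
qed

section \<open>The averages prescribed by a tuple of exponents\<close>

definition moves :: "nat list \<Rightarrow> real list" where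
  "moves ks = concat (map (\<lambda>k. replicate (k - 1) 0 @ [1]) ks)"

lemma moves_simps [simp]:
  "moves [] = []" "moves (k # ks) = replicate (k - 1) 0 @ 1 # moves ks"
  "moves (ks @ ls) = moves ks @ moves ls"
  by (simp_all add: moves_def)

lemma set_moves: "set (moves ks) \<subseteq> {0, 1}"
  by (induction ks) auto

lemma set_moves_unit: "set (moves ks) \<subseteq> {0..1}"
  using set_moves[of ks] by auto

lemma length_moves: "length ks \<le> length (moves ks)"
  by (induction ks) auto

lemma map_upt_split: "r \<le> m \<Longrightarrow> map f [0..<m] = map f [0..<r] @ map f [r..<m]"
  by (metis le_add_diff_inverse map_append upt_add_eq_append zero_le)

text \<open>
  Further averages stay in every closed ball that contains the present values; the ball of radius
  \<open>e\<close> around the present value at 0 is such a ball.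
\<close>

lemma fold_seg_avg_moves_tail_le:
  fixes g :: "real \<Rightarrow> 'a::banach"
  assumes "continuous_on {0..1} g" "r \<le> m"
    and "\<And>x. x \<in> {0..1} \<Longrightarrow>
      norm (fold seg_avg (moves (map k [0..<r])) g x - fold seg_avg (moves (map k [0..<r])) g 0) \<le> e"
  shows "norm (fold seg_avg (moves (map k [0..<m])) g 0 - fold seg_avg (moves (map k [0..<r])) g 0) \<le> e"
proof -
  define f where "f = fold seg_avg (moves (map k [0..<r])) g"
  define cs where "cs = moves (map k [r..<m])"
  have cs: "set cs \<subseteq> {0..1}" unfolding cs_def by (rule set_moves_unit)
  have f: "continuous_on {0..1} f"
    unfolding f_def by (intro continuous_on_fold_seg_avg assms set_moves_unit)
  have "norm (fold seg_avg cs (\<lambda>x. f x - f 0) 0) \<le> e"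
    by (rule norm_fold_seg_avg_le) (use cs f assms(3) in \<open>auto simp: f_def intro!: continuous_intros\<close>)
  also have "fold seg_avg cs (\<lambda>x. f x - f 0) 0 = fold seg_avg cs f 0 - f 0"
    by (subst fold_seg_avg_diff) (use cs f in auto)
  also have "fold seg_avg cs f = fold seg_avg (moves (map k [0..<m])) g"
    unfolding map_upt_split[OF assms(2)] by (simp add: f_def cs_def)
  finally show ?thesis by (simp add: f_def)
qed

lemma fold_seg_avg_moves_convergent:
  fixes g :: "real \<Rightarrow> 'a::banach"
  assumes g: "continuous_on {0..1} g"
  shows "convergent (\<lambda>r. fold seg_avg (moves (map k [0..<r])) g 0)"
  unfolding Cauchy_convergent_iff[symmetric]
proof (rule CauchyI')
  fix e :: real assume e: "e > 0"
  hence "e / 2 > 0" by simp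
  from fold_seg_avg_oscillation[OF g this] obtain N where
    N: "\<And>cs x y. set cs \<subseteq> {0..1} \<Longrightarrow> N \<le> length cs \<Longrightarrow> x \<in> {0..1} \<Longrightarrow> y \<in> {0..1} \<Longrightarrow>
      norm (fold seg_avg cs g x - fold seg_avg cs g y) < e / 2" by blast
  show "\<exists>M. \<forall>m\<ge>M. \<forall>n>m. dist (fold seg_avg (moves (map k [0..<m])) g 0)
      (fold seg_avg (moves (map k [0..<n])) g 0) < e"
  proof (intro exI allI impI)
    fix m n :: nat assume mn: "N \<le> m" "m < n"
    have "norm (fold seg_avg (moves (map k [0..<n])) g 0 - fold seg_avg (moves (map k [0..<m])) g 0)
      \<le> e / 2"
    proof (rule fold_seg_avg_moves_tail_le[OF g])
      fix x :: real assume "x \<in> {0..1}"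
      moreover have "N \<le> length (moves (map k [0..<m]))"
        using length_moves[of "map k [0..<m]"] mn by simp
      ultimately show "norm (fold seg_avg (moves (map k [0..<m])) g x
          - fold seg_avg (moves (map k [0..<m])) g 0) \<le> e / 2"
        using N[OF set_moves_unit, of "map k [0..<m]" x 0] by simp
    qed (use mn in simp)
    also have "e / 2 < e" using e by simp
    finally show "dist (fold seg_avg (moves (map k [0..<m])) g 0)
      (fold seg_avg (moves (map k [0..<n])) g 0) < e" by (simp add: dist_norm norm_minus_commute)
  qed
qed

section \<open>The kernel and its difference equation\<close>

lemma seg_avg_FTC:
  fixes G g :: "real \<Rightarrow> 'a::banach"
  assumes c: "c \<in> {0..1}" "x \<in> {0..1}" "x \<noteq> c"
    and G: "continuous_on {0..1} G"
    and d: "\<And>y. 0 < y \<Longrightarrow> y < 1 \<Longrightarrow> (G has_vector_derivative g y) (at y)"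
  shows "seg_avg c g x = (1 / (x - c)) *\<^sub>R (G x - G c)"
proof -
  define l where "l = (\<lambda>u. c + u * (x - c))"
  have "((\<lambda>u. (x - c) *\<^sub>R g (l u)) has_integral (G (l 1) - G (l 0))) {0..1}"
  proof (rule fundamental_theorem_of_calculus_interior)
    show "continuous_on {0..1} (\<lambda>u. G (l u))"
      unfolding l_def by (rule continuous_on_segment[OF G c(1,2)])
    fix u :: real assume u: "u \<in> {0<..<1}"
    have "l u = (1 - u) * c + u * x" by (simp add: l_def algebra_simps)
    moreover have "0 < (1 - u) * c + u * x"
      using c u by (smt (verit) atLeastAtMost_iff greaterThanLessThan_iff mult_nonneg_nonneg mult_pos_pos)
    moreover have "(1 - u) * (1 - c) + u * (1 - x) > 0"
      using c u by (smt (verit) atLeastAtMost_iff greaterThanLessThan_iff mult_nonneg_nonneg mult_pos_pos)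
    ultimately have "(G has_vector_derivative g (l u)) (at (l u))"
      by (intro d) (auto simp: algebra_simps)
    moreover have "(l has_vector_derivative (x - c)) (at u)"
      unfolding l_def has_real_derivative_iff_has_vector_derivative[symmetric]
      by (auto intro!: derivative_eq_intros)
    ultimately show "((\<lambda>u. G (l u)) has_vector_derivative (x - c) *\<^sub>R g (l u)) (at u)"
      using vector_diff_chain_at[of l "x - c" u G "g (l u)"] by (simp add: o_def)
  qed simp
  from has_integral_cmul[OF this, of "1 / (x - c)"] c(3)
  have "((\<lambda>u. g (l u)) has_integral (1 / (x - c)) *\<^sub>R (G x - G c)) {0..1}"
    by (simp add: l_def)
  thus ?thesis unfolding seg_avg_def l_def by (rule integral_unique)
qed

abbreviation cpow :: "complex \<Rightarrow> real \<Rightarrow> complex" where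
  "cpow s \<equiv> (\<lambda>x. of_real x powr s)"

lemma continuous_on_cpow: "Re s > 0 \<Longrightarrow> continuous_on {0..1} (cpow s)"
  by (intro continuous_intros) auto

lemma cpow_primitive:
  assumes "x > 0" "s \<noteq> -1"
  shows "((\<lambda>x. cpow (s + 1) x / (s + 1)) has_vector_derivative cpow s x) (at x)"
proof -
  have "s + 1 \<noteq> 0" using assms(2) by (metis add_eq_0_iff2)
  hence "((\<lambda>z. z powr (s + 1) / (s + 1)) has_field_derivative (of_real x powr s)) (at (of_real x))"
    using assms by (auto intro!: derivative_eq_intros simp: complex_nonpos_Reals_iff)
  from has_vector_derivative_real_field[OF this] show ?thesis by simp
qed

text \<open>
  The complex interpolation in \<open>s\<close> of the geometric sum of \<open>x ^ i\<close> over \<open>i < s\<close>; the value at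
  \<open>x = 1\<close> is the continuous extension.
\<close>

definition geom :: "complex \<Rightarrow> real \<Rightarrow> complex" where
  "geom s x = (if x = 1 then s else (1 - of_real x powr s) / (1 - of_real x))"

lemma seg_avg_0_cpow:
  assumes "Re s > 0" "x \<in> {0..1}"
  shows "seg_avg 0 (cpow s) x = cpow s x / (s + 1)"
proof (cases "x = 0")
  case False
  have s: "s \<noteq> -1" using assms(1) by auto
  have "seg_avg 0 (cpow s) x = (1 / (x - 0)) *\<^sub>R (cpow (s + 1) x / (s + 1) - cpow (s + 1) 0 / (s + 1))"
    by (rule seg_avg_FTC)
       (use assms False s cpow_primitive in \<open>auto intro!: continuous_intros simp: add_eq_0_iff2\<close>)
  thus ?thesis using False by (simp add: powr_add scaleR_conv_of_real)
qed simp

text \<open>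
  Besides driving the difference equation, this exhibits the kernel as an average of a power, from
  which its continuity and, for real parameter, its monotonicity in \<open>x\<close> are inherited.
\<close>

lemma seg_avg_1_cpow:
  assumes "Re s > 0" "x \<in> {0..1}"
  shows "seg_avg 1 (cpow s) x = geom (s + 1) x / (s + 1)"
proof (cases "x = 1")
  case False
  have s: "s \<noteq> -1" using assms(1) by auto
  have "seg_avg 1 (cpow s) x = (1 / (x - 1)) *\<^sub>R (cpow (s + 1) x / (s + 1) - cpow (s + 1) 1 / (s + 1))"
    by (rule seg_avg_FTC)
       (use assms False s cpow_primitive in \<open>auto intro!: continuous_intros simp: add_eq_0_iff2\<close>)
  also have "\<dots> = (cpow (s + 1) x - 1) / (of_real x - 1) / (s + 1)"
    by (simp add: scaleR_conv_of_real diff_divide_distrib mult.commute)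
  also have "(cpow (s + 1) x - 1) / (of_real x - 1) = geom (s + 1) x"
    using False minus_divide_divide[of "1 - cpow (s + 1) x" "1 - of_real x"] by (simp add: geom_def)
  finally show ?thesis .
next
  case True
  have s: "s + 1 \<noteq> 0" using assms(1) by (auto simp: complex_eq_iff)
  then show ?thesis using True by (simp add: geom_def)
qed

lemma geom_plus_1:
  assumes "Re s > 0"
  shows "geom (s + 1) x = geom s x + cpow s x"
proof (cases "x = 1")
  case False
  hence "1 - complex_of_real x \<noteq> 0" by (metis of_real_1 of_real_eq_iff right_minus_eq)
  moreover have "cpow (s + 1) x = cpow s x * of_real x"
    by (cases "x = 0") (simp_all add: powr_add)
  ultimately show ?thesis using False by (simp add: geom_def field_simps)
qed (simp add: geom_def)

lemma continuous_on_geom: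
  assumes "Re s > 0"
  shows "continuous_on {0..1} (geom s)"
proof -
  have "continuous_on {0..1} (\<lambda>x. (s + 1) * seg_avg 1 (cpow s) x - cpow s x)"
    by (intro continuous_intros continuous_on_seg_avg continuous_on_cpow assms) auto
  moreover have "(s + 1) * seg_avg 1 (cpow s) x - cpow s x = geom s x" if "x \<in> {0..1}" for x
  proof -
    have "s + 1 \<noteq> 0" using assms by (auto simp: complex_eq_iff)
    thus ?thesis using seg_avg_1_cpow[OF assms that] geom_plus_1[OF assms, of x] by simp
  qed
  ultimately show ?thesis by (rule continuous_on_eq)
qed

lemma fold_seg_avg_cpow:
  assumes "Re s > 0" "x \<in> {0..1}"
  shows "fold seg_avg (replicate n 0 @ [1]) (cpow s) x = geom (s + 1) x / (s + 1) ^ Suc n"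
  using assms(2)
proof (induction n arbitrary: x)
  case 0 thus ?case using seg_avg_1_cpow[OF assms(1)] by simp
next
  case (Suc n)
  let ?cs = "replicate n 0 @ [1::real]"
  have cs: "set ?cs \<subseteq> {0..1}" by auto
  have "fold seg_avg (replicate (Suc n) 0 @ [1]) (cpow s) x = fold seg_avg ?cs (seg_avg 0 (cpow s)) x"
    by simp
  also have "\<dots> = 1 / (s + 1) * fold seg_avg ?cs (cpow s) x + 0"
    by (rule fold_seg_avg_linear[OF bounded_linear_mult_right bounded_linear_zero
          continuous_on_cpow[OF assms(1)] continuous_on_cpow[OF assms(1)] _ cs Suc.prems])
       (use seg_avg_0_cpow[OF assms(1)] in auto)
  also have "\<dots> = geom (s + 1) x / (s + 1) ^ Suc (Suc n)"
    using Suc.IH[OF Suc.prems] by simp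
  finally show ?case .
qed

definition H_avg :: "complex \<Rightarrow> nat list \<Rightarrow> complex" where
  "H_avg s ks = fold seg_avg (moves ks) (geom s) 0"

lemma H_avg_Nil: "H_avg s [] = 1" if "s \<noteq> 0"
  using that by (simp add: H_avg_def geom_def)

lemma H_avg_1: "H_avg 1 ks = 1"
proof -
  have "geom 1 x = 1" for x by (auto simp: geom_def complex_eq_iff)
  hence "geom 1 = (\<lambda>_. 1)" by auto
  thus ?thesis by (simp add: H_avg_def)
qed

text \<open>
  Raising \<open>s\<close> by 1 adds \<open>x powr s\<close> to the kernel. The averages belonging to \<open>k\<close> turn this power into
  the kernel for \<open>s + 1\<close>, divided by \<open>(s + 1) ^ k\<close>, so that the averages belonging to \<open>ks\<close> act on a
  kernel again.
\<close>

lemma H_avg_plus_1: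
  assumes "Re s > 0" "k \<ge> 1"
  shows "H_avg (s + 1) (k # ks) = H_avg s (k # ks) + H_avg (s + 1) ks / (s + 1) ^ k"
proof -
  let ?cs = "moves (k # ks)"
  have cs: "set ?cs \<subseteq> {0..1}" "set (moves ks) \<subseteq> {0..1}" by (rule set_moves_unit)+
  have g: "continuous_on {0..1} (geom s)" "continuous_on {0..1} (cpow s)"
      "continuous_on {0..1} (geom (s + 1))"
    using assms by (intro continuous_on_geom continuous_on_cpow; simp)+
  have z: "(0::real) \<in> {0..1}" by simp
  have "fold seg_avg ?cs (geom (s + 1)) 0 = fold seg_avg ?cs (geom s) 0 + fold seg_avg ?cs (cpow s) 0"
    by (rule fold_seg_avg_linear[OF bounded_linear_ident bounded_linear_ident g(1,2) _ cs(1) z])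
       (use geom_plus_1[OF assms(1)] in auto)
  moreover have "fold seg_avg (moves ks) (fold seg_avg (replicate (k - 1) 0 @ [1]) (cpow s)) 0
      = 1 / (s + 1) ^ k * fold seg_avg (moves ks) (geom (s + 1)) 0 + 0"
    by (rule fold_seg_avg_linear[OF bounded_linear_mult_right bounded_linear_zero g(3,3) _ cs(2) z])
       (use fold_seg_avg_cpow[OF assms(1), of _ "k - 1"] assms(2) in auto)
  ultimately show ?thesis by (simp add: H_avg_def)
qed

lemma H_avg_plus_nat:
  assumes "Re s > 0" "k \<ge> 1"
  shows "H_avg (s + of_nat M) (k # ks) = H_avg s (k # ks) +
    (\<Sum>m=1..M. H_avg (s + of_nat m) ks / (s + of_nat m) ^ k)"
proof (induction M)
  case (Suc M)
  have "Re (s + of_nat M) > 0" using assms(1) by simp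
  from H_avg_plus_1[OF this assms(2), of ks] Suc.IH show ?case
    by (simp add: add_ac)
qed simp

section \<open>The finite sums and telescoping\<close>

abbreviation bounded_tuples :: "nat \<Rightarrow> nat \<Rightarrow> nat list set" where
  "bounded_tuples r M \<equiv> {ms. ms \<in> noninc_tuples r \<and> (\<forall>m\<in>set ms. m \<le> M)}"

lemma bounded_tuples_0: "bounded_tuples 0 M = {[]}"
  by (auto simp: noninc_tuples_def)

lemma bounded_tuples_Suc:
  "bounded_tuples (Suc r) M = (\<lambda>(m, ms). m # ms) ` (SIGMA m:{1..M}. bounded_tuples r m)"
proof (intro equalityI subsetI)
  fix ms assume "ms \<in> bounded_tuples (Suc r) M"
  then obtain m ms' where "ms = m # ms'" "m \<in> {1..M}" "ms' \<in> bounded_tuples r m"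
    by (cases ms) (auto simp: noninc_tuples_def)
  then show "ms \<in> (\<lambda>(m, ms). m # ms) ` (SIGMA m:{1..M}. bounded_tuples r m)" by force
qed (auto simp: noninc_tuples_def; meson le_trans)

lemma finite_bounded_tuples: "finite (bounded_tuples r M)"
proof (induction r arbitrary: M)
  case (Suc r)
  have "finite (SIGMA m:{1..M}. bounded_tuples r m)"
    by (rule finite_SigmaI) (use Suc in auto)
  then show ?case unfolding bounded_tuples_Suc by (rule finite_imageI)
qed (simp add: bounded_tuples_0)

lemma G_fin_Nil: "G_fin M s [] = 1"
  unfolding G_fin_def list.size bounded_tuples_0 by simp

lemma G_fin_Cons:
  "G_fin M s (k # ks) = (\<Sum>m=1..M. G_fin m s ks / (of_nat m + s) ^ k)"
proof -
  have inj: "inj_on (\<lambda>(m, ms). m # ms) (SIGMA m:{1..M}. bounded_tuples (length ks) m)"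
    by (auto simp: inj_on_def)
  have "G_fin M s (k # ks) = (\<Sum>(m, ms)\<in>(SIGMA m:{1..M}. bounded_tuples (length ks) m).
     1 / (\<Prod>i<length ks. (of_nat (ms ! i) + s) ^ (ks ! i)) / (of_nat m + s) ^ k)"
    unfolding G_fin_def length_Cons bounded_tuples_Suc
    by (subst sum.reindex[OF inj]) (simp add: prod.lessThan_Suc_shift case_prod_unfold mult.commute
      del: prod.lessThan_Suc)
  also have "\<dots> = (\<Sum>m=1..M. \<Sum>ms\<in>bounded_tuples (length ks) m.
     1 / (\<Prod>i<length ks. (of_nat (ms ! i) + s) ^ (ks ! i)) / (of_nat m + s) ^ k)"
    by (rule sum.Sigma[symmetric]) (auto intro: finite_bounded_tuples)
  finally show ?thesis by (simp add: G_fin_def sum_divide_distrib)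
qed

lemma H_fin_eq_G_fin: "H_fin M ks = G_fin M 0 ks"
  by (simp add: H_fin_def G_fin_def)

lemma H_avg_nat:
  assumes "\<forall>k\<in>set ks. 1 \<le> k" "M \<ge> 1"
  shows "H_avg (of_nat M) ks = H_fin M ks"
  using assms
proof (induction ks arbitrary: M)
  case Nil
  then show ?case by (simp add: H_avg_Nil H_fin_eq_G_fin G_fin_Nil)
next
  case (Cons k ks)
  from \<open>M \<ge> 1\<close> show ?case
  proof (induction M rule: dec_induct)
    case base
    have "H_fin 1 ks = 1" using Cons.IH[of 1] Cons.prems(1) H_avg_1 by simp
    then show ?case by (simp add: H_avg_1 H_fin_eq_G_fin G_fin_Cons)
  next
    case (step M)
    have "H_fin (Suc M) (k # ks) = H_fin M (k # ks) + H_fin (Suc M) ks / of_nat (Suc M) ^ k"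
      by (simp add: H_fin_eq_G_fin G_fin_Cons)
    moreover have "H_avg (of_nat (Suc M)) (k # ks)
        = H_avg (of_nat M) (k # ks) + H_avg (of_nat (Suc M)) ks / of_nat (Suc M) ^ k"
      using H_avg_plus_1[of "of_nat M" k ks] Cons.prems(1) step.hyps by (simp add: add.commute)
    ultimately show ?case using step Cons.IH[of "Suc M"] Cons.prems(1) by simp
  qed
qed

text \<open>
  The difference equation, summed over the first argument, contains values at the shifted points
  \<open>s + m\<close>; replacing these recursively leaves values at \<open>s\<close> only, with the nested sums as
  coefficients.
\<close>

lemma H_avg_telescope:
  assumes "Re s > 0" "\<forall>k\<in>set ks. 1 \<le> k"
  shows "H_avg (s + of_nat M) ks = (\<Sum>j=0..length ks. G_fin M s (take j ks) * H_avg s (drop j ks))"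
  using assms(2)
proof (induction ks arbitrary: M)
  case Nil
  have "s \<noteq> 0" "s + of_nat M \<noteq> 0" using assms(1) by (auto simp: complex_eq_iff)
  then show ?case by (simp add: H_avg_Nil G_fin_Nil)
next
  case (Cons k ks)
  have "(\<Sum>m=1..M. H_avg (s + of_nat m) ks / (s + of_nat m) ^ k)
      = (\<Sum>m=1..M. \<Sum>j=0..length ks. G_fin m s (take j ks) / (of_nat m + s) ^ k * H_avg s (drop j ks))"
    using Cons by (simp add: sum_divide_distrib add.commute)
  also have "\<dots> = (\<Sum>j=0..length ks. G_fin M s (k # take j ks) * H_avg s (drop j ks))"
    by (subst sum.swap) (simp add: G_fin_Cons sum_distrib_right)
  also have "\<dots> = (\<Sum>j=Suc 0..length (k # ks). G_fin M s (take j (k # ks)) * H_avg s (drop j (k # ks)))"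
    using sum.shift_bounds_cl_Suc_ivl[of "\<lambda>j. G_fin M s (take j (k # ks)) * H_avg s (drop j (k # ks))"
        0 "length ks"] by simp
  finally show ?case
    using H_avg_plus_nat[OF assms(1), of k M ks] Cons.prems
    by (simp add: sum.atLeast_Suc_atMost G_fin_Nil)
qed

section \<open>Weighted estimates near 1\<close>

lemma powr_le_exp:
  fixes y p :: real
  assumes "y > 0" "0 \<le> p" "p \<le> 1"
  shows "y powr p \<le> exp y"
proof -
  have "p * ln y \<le> y"
  proof (cases "ln y \<le> 0")
    case True
    hence "p * ln y \<le> 0" using assms by (simp add: mult_nonneg_nonpos)
    thus ?thesis using assms by linarith
  next
    case False
    hence "p * ln y \<le> 1 * ln y" using assms by (intro mult_right_mono) auto
    thus ?thesis using ln_less_self[OF assms(1)] by linarith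
  qed
  thus ?thesis using assms by (simp add: powr_def)
qed

text \<open>
  Since \<open>x powr \<sigma> \<le> exp (- \<sigma> * (1 - x))\<close>, decay in \<open>\<sigma>\<close> can be bought with a singularity at 1 of
  the same order \<open>p\<close>.
\<close>

lemma powr_decay:
  fixes x \<sigma> p :: real
  assumes "0 \<le> x" "x < 1" "\<sigma> > 0" "0 \<le> p" "p \<le> 1"
  shows "x powr \<sigma> \<le> \<sigma> powr (-p) * (1 - x) powr (-p)"
proof (cases "x = 0")
  case False
  define y where "y = \<sigma> * (1 - x)"
  have y: "y > 0" using assms by (simp add: y_def)
  have "ln x \<le> x - 1" using assms False by (intro ln_le_minus_one) simp
  hence "\<sigma> * ln x \<le> \<sigma> * (x - 1)" using assms by (intro mult_left_mono) auto
  hence "x powr \<sigma> \<le> exp (- y)"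
    using False by (simp add: powr_def y_def algebra_simps)
  also have "\<dots> \<le> y powr (-p)"
    using powr_le_exp[OF y assms(4,5)] y by (simp add: powr_minus exp_minus le_imp_inverse_le)
  also have "\<dots> = \<sigma> powr (-p) * (1 - x) powr (-p)"
    using assms by (simp add: y_def powr_mult)
  finally show ?thesis .
qed simp

lemma has_integral_powr_reflect:
  assumes "p < 1"
  shows "((\<lambda>u. (1 - u) powr (-p)) has_integral (1 / (1 - p))) {0..1::real}"
proof -
  have "((\<lambda>u. u powr (-p)) has_integral (1 / (1 - p))) {0..1::real}"
    using has_integral_powr_from_0[of "-p" 1] assms by simp
  hence "((\<lambda>u. (-u) powr (-p)) has_integral (1 / (1 - p))) {-1..-0::real}"
    by (subst has_integral_reflect_real) simp
  from has_integral_shift_real_ivl[OF this, of "-1"] show ?thesis by simp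
qed

text \<open>
  The point \<open>u * x\<close> lies to the left of \<open>u\<close>, so its weight is at most the integrable
  \<open>(1 - u) powr (-(1/2))\<close>, uniformly in \<open>x\<close>: averaging towards 0 removes the singularity.
\<close>

lemma seg_avg_0_weight:
  fixes g :: "real \<Rightarrow> 'a::banach"
  assumes "continuous_on {0..1} g"
    and le: "\<And>x. 0 \<le> x \<Longrightarrow> x < 1 \<Longrightarrow> norm (g x) \<le> C * (1 - x) powr (-(1/2))"
    and x: "x \<in> {0..1}"
  shows "norm (seg_avg 0 g x) \<le> 2 * C"
proof (rule norm_seg_avg_le)
  show "((\<lambda>u. C * (1 - u) powr (-(1/2))) has_integral 2 * C) {0..1}"
    using has_integral_mult_right[OF has_integral_powr_reflect[of "1/2"], of C] by (simp add: mult.commute)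
  have C: "C \<ge> 0" using order_trans[OF norm_ge_zero le[of 0]] by simp
  fix u :: real assume u: "0 < u" "u < 1"
  have ux: "u * x \<le> u" "0 \<le> u * x" using u x by (auto intro: mult_left_le)
  have "norm (g (u * x)) \<le> C * (1 - u * x) powr (-(1/2))" using ux u by (intro le) linarith+
  also have "\<dots> \<le> C * (1 - u) powr (-(1/2))"
    using ux u C by (intro mult_left_mono powr_mono2') linarith+
  finally show "norm (g (0 + u * (x - 0))) \<le> C * (1 - u) powr (-(1/2))" by simp
qed (use assms in auto)

text \<open>
  Averaging towards 1 keeps the singularity: the distance to 1 of a point of the segment is
  \<open>u * (1 - x)\<close>, so the weight factorises, and its integral over \<open>u\<close> contributes the factor 2.
\<close>

lemma seg_avg_1_weight:
  fixes g :: "real \<Rightarrow> 'a::banach"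
  assumes "continuous_on {0..1} g"
    and le: "\<And>x. 0 \<le> x \<Longrightarrow> x < 1 \<Longrightarrow> norm (g x) \<le> C * (1 - x) powr (-(1/2))"
    and x: "0 \<le> x" "x < 1"
  shows "norm (seg_avg 1 g x) \<le> 2 * C * (1 - x) powr (-(1/2))"
proof (rule norm_seg_avg_le)
  have "((\<lambda>u. u powr (-(1/2))) has_integral 2) {0..1::real}"
    using has_integral_powr_from_0[of "-(1/2)" 1] by simp
  from has_integral_mult_right[OF this, of "C * (1 - x) powr (-(1/2))"]
  show "((\<lambda>u. C * (1 - x) powr (-(1/2)) * u powr (-(1/2))) has_integral
      2 * C * (1 - x) powr (-(1/2))) {0..1}" by (simp add: mult_ac)
  fix u :: real assume u: "0 < u" "u < 1"
  have "u * (1 - x) \<le> 1 * 1" using u x by (intro mult_mono) auto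
  moreover have "0 < u * (1 - x)" using u x by simp
  ultimately have "norm (g (1 - u * (1 - x))) \<le> C * (u * (1 - x)) powr (-(1/2))"
    using le[of "1 - u * (1 - x)"] by simp
  also have "\<dots> = C * (1 - x) powr (-(1/2)) * u powr (-(1/2))"
    using u x by (simp add: powr_mult)
  also have "1 - u * (1 - x) = 1 + u * (x - 1)" by (simp add: algebra_simps)
  finally show "norm (g (1 + u * (x - 1))) \<le> C * (1 - x) powr (-(1/2)) * u powr (-(1/2))" .
qed (use assms in auto)

lemma fold_seg_avg_weight:
  fixes g :: "real \<Rightarrow> 'a::banach"
  assumes "continuous_on {0..1} g"
    and "\<And>x. 0 \<le> x \<Longrightarrow> x < 1 \<Longrightarrow> norm (g x) \<le> C * (1 - x) powr (-(1/2))"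
    and "set cs \<subseteq> {0, 1}" and x: "0 \<le> x" "x < 1"
  shows "norm (fold seg_avg cs g x) \<le> 2 ^ length cs * C * (1 - x) powr (-(1/2))"
  using assms(1-3)
proof (induction cs arbitrary: g C)
  case (Cons c cs)
  have C: "C \<ge> 0" using order_trans[OF norm_ge_zero Cons.prems(2)[of 0]] by simp
  have "norm (fold seg_avg cs (seg_avg c g) x) \<le> 2 ^ length cs * (2 * C) * (1 - x) powr (-(1/2))"
  proof (rule Cons.IH)
    fix y :: real assume y: "0 \<le> y" "y < 1"
    consider "c = 0" | "c = 1" using Cons.prems(3) by auto
    then show "norm (seg_avg c g y) \<le> 2 * C * (1 - y) powr (-(1/2))"
    proof cases
      case 1
      have "norm (seg_avg 0 g y) \<le> 2 * C * 1"
        using seg_avg_0_weight[OF Cons.prems(1,2)] y by auto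
      also have "2 * C * 1 \<le> 2 * C * (1 - y) powr (-(1/2))"
        using y C powr_mono2'[of "-(1/2)" "1 - y" 1] by (intro mult_left_mono) auto
      finally show ?thesis using 1 by simp
    qed (use seg_avg_1_weight[OF Cons.prems(1,2) y] in auto)
  qed (use Cons.prems in \<open>auto intro!: continuous_on_seg_avg\<close>)
  then show ?case by (simp add: mult_ac)
qed (use x in simp)

lemma geom_add: "geom (s + t) x - geom t x = cpow t x * geom s x"
proof (cases "x = 1")
  case False
  then show ?thesis
    by (cases "x = 0") (simp_all add: geom_def powr_add diff_divide_distrib[symmetric] right_diff_distrib mult.commute)
qed (simp add: geom_def)

lemma norm_cpow: "x \<ge> 0 \<Longrightarrow> norm (cpow s x) = x powr Re s"
  by (subst norm_powr_real_powr) auto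

text \<open>
  The kernels for \<open>s + M\<close> and \<open>M\<close> differ by \<open>x ^ M\<close> times a bounded function. This is small in
  the weighted norm although not uniformly on [0,1], and the final evaluation takes place at 0,
  where the weight is 1.
\<close>

lemma H_avg_shift_tendsto_0:
  assumes s: "Re s > 0"
  shows "(\<lambda>M. H_avg (s + of_nat M) ks - H_avg (of_nat M) ks) \<longlonglongrightarrow> 0"
proof -
  have "bounded (geom s ` {0..1})"
    by (intro compact_imp_bounded compact_continuous_image continuous_on_geom s) simp
  then obtain B where B: "\<And>x. x \<in> {0..1} \<Longrightarrow> norm (geom s x) \<le> B"
    unfolding bounded_iff by blast
  have B0: "B \<ge> 0" using order_trans[OF norm_ge_zero B[of 0]] by simp
  let ?cs = "moves ks"
  have "norm (H_avg (s + of_nat M) ks - H_avg (of_nat M) ks)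
      \<le> 2 ^ length ?cs * B * real M powr (-(1/2))" if M: "M \<ge> 1" for M
  proof -
    have c: "continuous_on {0..1} (geom (s + of_nat M))" "continuous_on {0..1} (geom (of_nat M))"
      using s M by (auto intro!: continuous_on_geom simp: add_pos_nonneg)
    have "norm (fold seg_avg ?cs (\<lambda>x. geom (s + of_nat M) x - geom (of_nat M) x) 0)
        \<le> 2 ^ length ?cs * (B * real M powr (-(1/2))) * (1 - 0) powr (-(1/2))"
    proof (rule fold_seg_avg_weight)
      fix x :: real assume x: "0 \<le> x" "x < 1"
      have "norm (geom (s + of_nat M) x - geom (of_nat M) x) = x powr real M * norm (geom s x)"
        using x by (simp add: geom_add norm_mult norm_cpow)
      also have "\<dots> \<le> (real M powr (-(1/2)) * (1 - x) powr (-(1/2))) * B"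
        using powr_decay[OF x, of "real M" "1/2"] M x by (intro mult_mono B) auto
      finally show "norm (geom (s + of_nat M) x - geom (of_nat M) x)
          \<le> B * real M powr (-(1/2)) * (1 - x) powr (-(1/2))" by (simp add: mult_ac)
    qed (use c set_moves in \<open>auto intro!: continuous_intros\<close>)
    thus ?thesis
      using fold_seg_avg_diff[OF c set_moves_unit, of 0 ks] by (simp add: H_avg_def)
  qed
  then have "eventually (\<lambda>M. norm (H_avg (s + of_nat M) ks - H_avg (of_nat M) ks)
      \<le> 2 ^ length ?cs * B * real M powr (-(1/2))) sequentially"
    by (intro eventually_sequentiallyI[of 1])
  moreover have "(\<lambda>M. real M powr (-(1/2))) \<longlonglongrightarrow> 0"
    by (rule tendsto_neg_powr) (auto intro: filterlim_real_sequentially)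
  from tendsto_mult_left[OF this, of "2 ^ length ?cs * B"]
  have "(\<lambda>M. 2 ^ length ?cs * B * real M powr (-(1/2))) \<longlonglongrightarrow> 0" by simp
  ultimately show ?thesis by (rule Lim_null_comparison)
qed

lemma H_star_eq_H_avg:
  assumes s: "Re s > 0" and "\<forall>k\<in>set ks. 1 \<le> k"
  shows "H_star s ks = H_avg s ks"
  using assms(2)
proof (induction "length ks" arbitrary: ks rule: less_induct)
  case less
  show ?case
  proof (cases ks)
    case Nil
    moreover have "s \<noteq> 0" using s by auto
    ultimately show ?thesis by (simp add: H_avg_Nil)
  next
    case (Cons k ls)
    let ?S = "\<lambda>M. \<Sum>j\<in>{1..length ks}. G_fin M s (take j ks) * H_star s (drop j ks)"
    have "?S M = (\<Sum>j\<in>{1..length ks}. G_fin M s (take j ks) * H_avg s (drop j ks))" for M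
    proof (rule sum.cong)
      fix j assume j: "j \<in> {1..length ks}"
      have "H_star s (drop j ks) = H_avg s (drop j ks)"
        by (rule less.hyps) (use j less.prems in \<open>auto dest: in_set_dropD\<close>)
      thus "G_fin M s (take j ks) * H_star s (drop j ks) = G_fin M s (take j ks) * H_avg s (drop j ks)"
        by simp
    qed simp
    hence S: "?S M = H_avg (s + of_nat M) ks - H_avg s ks" for M
      unfolding H_avg_telescope[OF s less.prems] by (simp add: sum.atLeast_Suc_atMost G_fin_Nil)
    have "(\<lambda>M. H_avg s ks - (H_avg (s + of_nat M) ks - H_avg (of_nat M) ks)) \<longlonglongrightarrow> H_avg s ks - 0"
      by (intro tendsto_intros H_avg_shift_tendsto_0 s)
    moreover have "eventually (\<lambda>M. H_avg s ks - (H_avg (s + of_nat M) ks - H_avg (of_nat M) ks)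
        = H_fin M ks - ?S M) sequentially"
      using eventually_ge_at_top[of 1]
      by eventually_elim (subst S, simp add: H_avg_nat[OF less.prems])
    ultimately have "(\<lambda>M. H_fin M ks - ?S M) \<longlonglongrightarrow> H_avg s ks"
      by (simp add: filterlim_cong)
    thus ?thesis unfolding Cons H_star.simps by (rule limI)
  qed
qed

section \<open>Digit expansions from averages of increasing functions\<close>

lemma strict_mono_on_seg_avg:
  fixes g :: "real \<Rightarrow> real"
  assumes g: "continuous_on {0..1} g" "strict_mono_on {0..1} g" and c: "c \<in> {0..1}"
  shows "strict_mono_on {0..1} (seg_avg c g)"
proof (rule strict_mono_onI)
  fix x y :: real assume xy: "x \<in> {0..1}" "y \<in> {0..1}" "x < y"
  show "seg_avg c g x < seg_avg c g y"
    unfolding seg_avg_def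
  proof (rule integral_less_real)
    fix u :: real assume u: "u \<in> {0<..<1}"
    hence "c + u * (x - c) < c + u * (y - c)" using xy by simp
    moreover have "c + u * (x - c) \<in> {0..1}" "c + u * (y - c) \<in> {0..1}"
      using segment_in_unit[OF c] xy u by auto
    ultimately show "g (c + u * (x - c)) < g (c + u * (y - c))"
      by (intro strict_mono_onD[OF g(2)])
  qed (use continuous_on_segment[OF g(1) c] xy in auto)
qed

definition increasing_profile :: "(real \<Rightarrow> real) \<Rightarrow> bool" where
  "increasing_profile g \<longleftrightarrow> continuous_on {0..1} g \<and> strict_mono_on {0..1} g"

lemma increasing_profile_less: "increasing_profile g \<Longrightarrow> g 0 < g 1"
  using strict_mono_onD[of "{0..1}" g 0 1] by (simp add: increasing_profile_def)

lemma increasing_profile_seg_avg: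
  "increasing_profile g \<Longrightarrow> c \<in> {0..1} \<Longrightarrow> increasing_profile (seg_avg c g)"
  by (auto simp: increasing_profile_def intro!: continuous_on_seg_avg strict_mono_on_seg_avg)

lemma increasing_profile_fold:
  "increasing_profile g \<Longrightarrow> set cs \<subseteq> {0..1} \<Longrightarrow> increasing_profile (fold seg_avg cs g)"
proof (induction cs arbitrary: g)
  case (Cons c cs)
  then show ?case using increasing_profile_seg_avg[of g c] by simp
qed simp

lemma increasing_profile_funpow:
  "increasing_profile g \<Longrightarrow> increasing_profile ((seg_avg 0 ^^ n) g)"
  by (induction n) (auto intro: increasing_profile_seg_avg)

text \<open>
  The cut points dividing the range of \<open>g\<close> among the possible next exponents.
\<close>

definition cut :: "(real \<Rightarrow> real) \<Rightarrow> nat \<Rightarrow> real" where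
  "cut g n = (seg_avg 0 ^^ n) g 1"

lemma cut_0 [simp]: "cut g 0 = g 1"
  by (simp add: cut_def)

text \<open>
  Adjacent exponents share an endpoint because averaging over all of [0,1] can be done towards
  either end: the left endpoint for \<open>k\<close> is a mean over [0,1], which is also the right endpoint
  for \<open>k + 1\<close>.
\<close>

lemma fold_moves_endpoints:
  assumes "k \<ge> 1"
  shows "fold seg_avg (moves [k]) g 1 = cut g (k - 1)" "fold seg_avg (moves [k]) g 0 = cut g k"
proof -
  obtain n where "k = Suc n" using assms by (cases k) auto
  thus "fold seg_avg (moves [k]) g 0 = cut g k"
    by (simp add: cut_def seg_avg_opposite_endpoints)
qed (simp add: cut_def)

lemma cut_Suc_less:
  assumes "increasing_profile g"
  shows "cut g (Suc n) < cut g n"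
proof -
  have "increasing_profile (seg_avg 1 ((seg_avg 0 ^^ n) g))"
    by (intro increasing_profile_seg_avg increasing_profile_funpow assms) auto
  from increasing_profile_less[OF this] show ?thesis
    by (simp add: cut_def seg_avg_opposite_endpoints)
qed

lemma cut_antimono: "increasing_profile g \<Longrightarrow> m \<le> n \<Longrightarrow> cut g n \<le> cut g m"
  by (rule lift_Suc_antimono_le[of "cut g"]) (auto intro: less_imp_le cut_Suc_less)

lemma funpow_seg_avg_0_base: "(seg_avg 0 ^^ n) g 0 = g 0"
  by (induction n) auto

lemma cut_greater:
  assumes "increasing_profile g"
  shows "g 0 < cut g n"
  using increasing_profile_less[OF increasing_profile_funpow[OF assms, of n]]
  by (simp add: cut_def funpow_seg_avg_0_base)

text \<open>
  The cut points exhaust the interval: repeated averages towards 0 flatten \<open>g\<close> while keeping its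
  value at 0.
\<close>

lemma cut_eventually_less:
  assumes g: "increasing_profile g" and "g 0 < x"
  obtains n where "cut g n < x"
proof -
  have "continuous_on {0..1} g" "x - g 0 > 0" using assms by (auto simp: increasing_profile_def)
  from fold_seg_avg_oscillation[OF this] obtain N where
    N: "\<And>cs y z. set cs \<subseteq> {0..1} \<Longrightarrow> N \<le> length cs \<Longrightarrow> y \<in> {0..1} \<Longrightarrow> z \<in> {0..1} \<Longrightarrow>
      norm (fold seg_avg cs g y - fold seg_avg cs g z) < x - g 0" by blast
  have "norm (cut g N - g 0) < x - g 0"
    using N[of "replicate N 0" 1 0] by (simp add: cut_def funpow_seg_avg_0_base set_replicate_conv_if)
  hence "cut g N < x" by (simp add: abs_less_iff)
  thus ?thesis by (rule that)
qed

lemma ex_digit: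
  assumes g: "increasing_profile g" and x: "x \<in> {g 0<..g 1}"
  obtains k where "k \<ge> 1" "x \<in> {cut g k<..cut g (k - 1)}"
proof -
  from x obtain n where "cut g n < x" using cut_eventually_less[OF g, of x] by auto
  define k where "k = (LEAST n. cut g n < x)"
  have 1: "cut g k < x" unfolding k_def by (rule LeastI) fact
  have 2: "k \<noteq> 0" using 1 x by (metis cut_0 greaterThanAtMost_iff not_le)
  have "\<not> cut g (k - 1) < x"
    by (rule not_less_Least[of "k - 1" "\<lambda>n. cut g n < x"]) (use 2 in \<open>simp add: k_def\<close>)
  with 1 2 show ?thesis by (intro that[of k]) auto
qed

definition profile :: "(real \<Rightarrow> real) \<Rightarrow> nat list \<Rightarrow> real \<Rightarrow> real" where
  "profile f ks = fold seg_avg (moves ks) f"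

lemma increasing_profile_profile: "increasing_profile f \<Longrightarrow> increasing_profile (profile f ks)"
  unfolding profile_def by (intro increasing_profile_fold set_moves_unit)

lemma profile_snoc:
  assumes "k \<ge> 1"
  shows "profile f (ks @ [k]) 0 = cut (profile f ks) k"
    "profile f (ks @ [k]) 1 = cut (profile f ks) (k - 1)"
  using fold_moves_endpoints[OF assms, of "profile f ks"] by (simp_all add: profile_def)

text \<open>
  This will turn out to be the set of values at the sequences of exponents that begin with \<open>ks\<close>.
\<close>

definition cylinder :: "(real \<Rightarrow> real) \<Rightarrow> nat list \<Rightarrow> real set" where
  "cylinder f ks = {profile f ks 0<..profile f ks 1}"

lemma cylinder_snoc:
  "k \<ge> 1 \<Longrightarrow> cylinder f (ks @ [k]) = {cut (profile f ks) k<..cut (profile f ks) (k - 1)}"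
  by (simp add: cylinder_def profile_snoc)

lemma cylinder_snoc_disjoint:
  assumes f: "increasing_profile f" and "1 \<le> k" "k < l"
  shows "cylinder f (ks @ [k]) \<inter> cylinder f (ks @ [l]) = {}"
proof -
  have "cut (profile f ks) (l - 1) \<le> cut (profile f ks) k"
    by (rule cut_antimono[OF increasing_profile_profile[OF f]]) (use assms in simp)
  thus ?thesis using assms by (auto simp: cylinder_snoc)
qed

abbreviation limit_value :: "(real \<Rightarrow> real) \<Rightarrow> (nat \<Rightarrow> nat) \<Rightarrow> real" where
  "limit_value f k \<equiv> lim (\<lambda>r. profile f (map k [0..<r]) 0)"

lemma limit_value_tendsto:
  assumes "increasing_profile f"
  shows "(\<lambda>r. profile f (map k [0..<r]) 0) \<longlonglongrightarrow> limit_value f k"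
  using fold_seg_avg_moves_convergent[of f k] assms
  by (simp add: convergent_LIMSEQ_iff increasing_profile_def profile_def)

text \<open>
  Left endpoints increase strictly and right endpoints decrease weakly along a sequence of
  exponents. The strictness is what makes the cylinders open on the left; on the right, equality is
  attained when only exponents 1 follow.
\<close>

lemma limit_value_in_cylinder:
  assumes f: "increasing_profile f" and k: "k \<in> T_hat"
  shows "limit_value f k \<in> cylinder f (map k [0..<r])"
proof -
  define a where "a = (\<lambda>r. profile f (map k [0..<r]) 0)"
  define b where "b = (\<lambda>r. profile f (map k [0..<r]) 1)"
  have k1: "k r \<ge> 1" for r using k by (auto simp: T_hat_def)
  note P = increasing_profile_profile[OF f]
  have a: "a r < a (Suc r)" for r
    using profile_snoc(1)[OF k1, of f "map k [0..<r]" r] cut_greater[OF P] by (simp add: a_def)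
  have b: "b (Suc r) \<le> b r" for r
    using profile_snoc(2)[OF k1, of f "map k [0..<r]" r] cut_antimono[OF P, of 0]
    by (simp add: b_def)
  have ab: "a r \<le> b r" for r
    using increasing_profile_less[OF P] by (simp add: a_def b_def less_imp_le)
  have lim: "a \<longlonglongrightarrow> limit_value f k"
    unfolding a_def by (rule limit_value_tendsto[OF f])
  have mono: "incseq a" using a by (intro incseq_SucI less_imp_le)
  have "a r < a (Suc r)" by (rule a)
  also have "a (Suc r) \<le> limit_value f k" by (rule incseq_le[OF mono lim])
  finally have 1: "a r < limit_value f k" .
  have anti: "decseq b" using b by (intro decseq_SucI)
  have "a m \<le> b r" if "r \<le> m" for m
    using ab[of m] decseqD[OF anti that] by linarith
  hence "limit_value f k \<le> b r" by (intro LIMSEQ_le_const2[OF lim] exI allI impI)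
  with 1 show ?thesis by (simp add: cylinder_def a_def b_def)
qed

lemma limit_value_unique:
  assumes f: "increasing_profile f" and x: "\<And>r. x \<in> cylinder f (map k [0..<r])"
  shows "limit_value f k = x"
proof -
  have "(\<lambda>r. profile f (map k [0..<r]) 0) \<longlonglongrightarrow> x"
  proof (rule LIMSEQ_I)
    fix e :: real assume "e > 0"
    moreover have "continuous_on {0..1} f" using f by (simp add: increasing_profile_def)
    ultimately obtain N where
      N: "\<And>cs y z. set cs \<subseteq> {0..1} \<Longrightarrow> N \<le> length cs \<Longrightarrow> y \<in> {0..1} \<Longrightarrow> z \<in> {0..1} \<Longrightarrow>
      norm (fold seg_avg cs f y - fold seg_avg cs f z) < e" 
      using fold_seg_avg_oscillation by metis
    show "\<exists>N. \<forall>r\<ge>N. norm (profile f (map k [0..<r]) 0 - x) < e"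
    proof (intro exI allI impI)
      fix r assume "r \<ge> N"
      hence "N \<le> length (moves (map k [0..<r]))" using length_moves[of "map k [0..<r]"] by simp
      from N[OF set_moves_unit this, of 0 1] x[of r]
      show "norm (profile f (map k [0..<r]) 0 - x) < e"
        by (simp add: profile_def cylinder_def)
    qed
  qed
  thus ?thesis by (rule limI)
qed

lemma ex_expansion:
  assumes f: "increasing_profile f" and x: "x \<in> {f 0<..f 1}"
  obtains k where "k \<in> T_hat" "\<And>r. x \<in> cylinder f (map k [0..<r])"
proof -
  have ex: "\<exists>n. 1 \<le> n \<and> x \<in> cylinder f (ks @ [n])" if "x \<in> cylinder f ks" for ks
  proof -
    from that have "x \<in> {profile f ks 0<..profile f ks 1}" by (simp add: cylinder_def)
    from ex_digit[OF increasing_profile_profile[OF f] this] obtain n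
      where "1 \<le> n" "x \<in> {cut (profile f ks) n<..cut (profile f ks) (n - 1)}" .
    thus ?thesis using cylinder_snoc[of n f ks] by blast
  qed
  define d where "d = (\<lambda>ks. SOME n. 1 \<le> n \<and> x \<in> cylinder f (ks @ [n]))"
  have d: "1 \<le> d ks" "x \<in> cylinder f (ks @ [d ks])" if "x \<in> cylinder f ks" for ks
    using someI_ex[OF ex[OF that]] by (simp_all add: d_def)
  define pre where "pre = (\<lambda>r. ((\<lambda>ks. ks @ [d ks]) ^^ r) [])"
  define k where "k = (\<lambda>r. d (pre r))"
  have pre: "pre r = map k [0..<r]" for r
    by (induction r) (simp_all add: pre_def k_def)
  have cyl: "x \<in> cylinder f (pre r)" for r
  proof (induction r)
    case 0 show ?case using x by (simp add: pre_def cylinder_def profile_def)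
  next
    case (Suc r) thus ?case using d(2)[OF Suc] by (simp add: pre_def)
  qed
  show ?thesis
  proof
    show "k \<in> T_hat" using d(1)[OF cyl] by (simp add: T_hat_def k_def)
    show "x \<in> cylinder f (map k [0..<r])" for r using cyl[of r] by (simp add: pre)
  qed
qed

text \<open>
  At the first index where two sequences differ their cylinders become disjoint, which gives
  injectivity; greedy choice of digits gives surjectivity.
\<close>

lemma bij_betw_limit_value:
  assumes f: "increasing_profile f"
  shows "bij_betw (limit_value f) T_hat {f 0<..f 1}"
  unfolding bij_betw_def
proof
  show "inj_on (limit_value f) T_hat"
  proof (rule inj_onI, rule ccontr)
    fix k l assume kl: "k \<in> T_hat" "l \<in> T_hat" "limit_value f k = limit_value f l" "k \<noteq> l"
    define r where "r = (LEAST r. k r \<noteq> l r)"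
    have "\<exists>r. k r \<noteq> l r" using kl(4) by auto
    hence r: "k r \<noteq> l r" unfolding r_def by (rule LeastI_ex)
    have "k i = l i" if "i < r" for i using not_less_Least[of i "\<lambda>r. k r \<noteq> l r"] that by (auto simp: r_def)
    hence pre: "map k [0..<r] = map l [0..<r]" by simp
    have "limit_value f k \<in> cylinder f (map k [0..<r] @ [k r])"
      using limit_value_in_cylinder[OF f kl(1), of "Suc r"] by simp
    moreover have "limit_value f k \<in> cylinder f (map k [0..<r] @ [l r])"
      using limit_value_in_cylinder[OF f kl(2), of "Suc r"] unfolding kl(3) pre by simp
    moreover have "1 \<le> k r" "1 \<le> l r" using kl by (simp_all add: T_hat_def)
    moreover have "k r < l r \<or> l r < k r" using r by auto
    ultimately show False
      using cylinder_snoc_disjoint[OF f, of "k r" "l r" "map k [0..<r]"]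
        cylinder_snoc_disjoint[OF f, of "l r" "k r" "map k [0..<r]"] by blast
  qed
  show "limit_value f ` T_hat = {f 0<..f 1}"
  proof (intro equalityI subsetI)
    fix y assume "y \<in> limit_value f ` T_hat"
    then show "y \<in> {f 0<..f 1}"
      using limit_value_in_cylinder[OF f, of _ 0] by (auto simp: cylinder_def profile_def)
  next
    fix x assume "x \<in> {f 0<..f 1}"
    from ex_expansion[OF f this] obtain k
      where k: "k \<in> T_hat" "\<And>r. x \<in> cylinder f (map k [0..<r])" by blast
    have "limit_value f k = x" by (rule limit_value_unique[OF f k(2)])
    with k(1) show "x \<in> limit_value f ` T_hat" by blast
  qed
qed

section \<open>Bijectivity for real parameter\<close>

text \<open>
  The kernel for real \<open>s > 1\<close>, written as an average of an increasing function so that its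
  monotonicity is inherited.
\<close>

definition geom_real :: "real \<Rightarrow> real \<Rightarrow> real" where
  "geom_real s x = s * seg_avg 1 (\<lambda>x. x powr (s - 1)) x"

lemma increasing_profile_powr:
  assumes "p > 0"
  shows "increasing_profile (\<lambda>x. x powr p)"
  unfolding increasing_profile_def
proof
  show "continuous_on {0..1} (\<lambda>x::real. x powr p)"
    using assms by (intro continuous_on_powr' continuous_on_id continuous_on_const) auto
  show "strict_mono_on {0..1} (\<lambda>x::real. x powr p)"
    using assms by (intro strict_mono_onI powr_less_mono2) auto
qed

lemma geom_of_real:
  assumes "s > 1" "x \<in> {0..1}"
  shows "geom (of_real s) x = of_real (geom_real s x)"
proof -
  have c: "continuous_on {0..1} (\<lambda>x. x powr (s - 1))"
    using increasing_profile_powr[of "s - 1"] assms by (simp add: increasing_profile_def)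
  have "seg_avg 1 (cpow (of_real (s - 1))) x = of_real (seg_avg 1 (\<lambda>x. x powr (s - 1)) x) + 0"
    by (rule seg_avg_linear[OF bounded_linear_of_real bounded_linear_zero c c])
       (use assms in \<open>auto simp: powr_of_real simp del: of_real_diff\<close>)
  moreover have "seg_avg 1 (cpow (of_real (s - 1))) x = geom (of_real (s - 1) + 1) x / (of_real (s - 1) + 1)"
    by (rule seg_avg_1_cpow) (use assms in auto)
  ultimately have "of_real (seg_avg 1 (\<lambda>x. x powr (s - 1)) x) = geom (of_real s) x / of_real s"
    by simp
  thus ?thesis using assms by (simp add: geom_real_def)
qed

lemma increasing_profile_geom_real:
  assumes "s > 1"
  shows "increasing_profile (geom_real s)"
proof -
  have "increasing_profile (seg_avg 1 (\<lambda>x. x powr (s - 1)))"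
    by (intro increasing_profile_seg_avg increasing_profile_powr) (use assms in auto)
  hence g: "continuous_on {0..1} (seg_avg 1 (\<lambda>x. x powr (s - 1)))"
      "strict_mono_on {0..1} (seg_avg 1 (\<lambda>x. x powr (s - 1)))"
    by (simp_all add: increasing_profile_def)
  show ?thesis unfolding increasing_profile_def geom_real_def[abs_def]
  proof
    show "continuous_on {0..1} (\<lambda>x. s * seg_avg 1 (\<lambda>x. x powr (s - 1)) x)"
      by (intro continuous_on_mult_left g)
    show "strict_mono_on {0..1} (\<lambda>x. s * seg_avg 1 (\<lambda>x. x powr (s - 1)) x)"
      using g(2) assms by (simp add: strict_mono_on_def)
  qed
qed

lemma H_avg_of_real:
  assumes "s > 1"
  shows "H_avg (of_real s) ks = of_real (profile (geom_real s) ks 0)"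
proof -
  have c: "continuous_on {0..1} (geom_real s)"
    using increasing_profile_geom_real[OF assms] by (simp add: increasing_profile_def)
  have "H_avg (of_real s) ks = of_real (profile (geom_real s) ks 0) + 0"
    unfolding H_avg_def profile_def
    by (rule fold_seg_avg_linear[OF bounded_linear_of_real bounded_linear_zero c c _ set_moves_unit])
       (use geom_of_real[OF assms] in auto)
  thus ?thesis by simp
qed

lemma bij_betw_frak_h:
  assumes s: "s > 1"
  shows "bij_betw (frak_h (of_real s)) T_hat (complex_of_real ` {1<..s})"
proof -
  note f = increasing_profile_geom_real[OF s]
  have "complex_of_real (geom_real s 0) = of_real 1" "complex_of_real (geom_real s 1) = of_real s"
    using geom_of_real[OF s, of 0] geom_of_real[OF s, of 1] s by (simp_all add: geom_def)
  hence e: "geom_real s 0 = 1" "geom_real s 1 = s"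
    by (simp_all only: of_real_eq_iff)
  have "frak_h (of_real s) k = of_real (limit_value (geom_real s) k)" if "k \<in> T_hat" for k
  proof -
    have "H_star (of_real s) (map k [0..<r]) = of_real (profile (geom_real s) (map k [0..<r]) 0)" for r
      using s that H_star_eq_H_avg[of "of_real s" "map k [0..<r]"] H_avg_of_real[OF s]
      by (auto simp: T_hat_def)
    thus ?thesis unfolding frak_h_def
      using tendsto_of_real[OF limit_value_tendsto[OF f, of k], where ?'a=complex] by (simp add: limI)
  qed
  moreover have "bij_betw (of_real \<circ> limit_value (geom_real s)) T_hat (complex_of_real ` {1<..s})"
    by (rule bij_betw_trans[OF bij_betw_limit_value[OF f, unfolded e]])
       (auto simp: bij_betw_def inj_on_def)
  ultimately show ?thesis by (simp cong: bij_betw_cong)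
qed

section \<open>Comparison with zeta values\<close>

lemma norm_geom_diff_le:
  assumes "0 \<le> x" "x < 1" "\<sigma> > 0" "\<sigma> \<le> Re s" "\<sigma> \<le> Re t"
  shows "norm (geom s x - geom t x) \<le> 2 * \<sigma> powr (-(1/4)) * (1 - x) powr (-(5/4))"
proof -
  have le: "norm (cpow z x) \<le> x powr \<sigma>" if "\<sigma> \<le> Re z" for z
    using that assms powr_mono'[of \<sigma> "Re z" x] by (simp add: norm_cpow)
  have "geom s x - geom t x = (cpow t x - cpow s x) / of_real (1 - x)"
    using assms by (simp add: geom_def diff_divide_distrib[symmetric])
  hence "norm (geom s x - geom t x) = norm (cpow t x - cpow s x) / (1 - x)"
    using assms by (simp only: norm_divide norm_of_real)
  also have "\<dots> \<le> (2 * x powr \<sigma>) / (1 - x)"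
    using norm_triangle_ineq4[of "cpow t x" "cpow s x"] le[OF assms(4)] le[OF assms(5)] assms
    by (intro divide_right_mono) linarith+
  also have "\<dots> \<le> (2 * (\<sigma> powr (-(1/4)) * (1 - x) powr (-(1/4)))) / (1 - x)"
    using powr_decay[OF assms(1-3), of "1/4"] assms by (intro divide_right_mono mult_left_mono) auto
  also have "(1 - x) powr (-(5/4)) = (1 - x) powr (-(1/4)) / (1 - x)"
    using assms powr_diff[of "1 - x" "-(1/4)" 1] by simp
  hence "(2 * (\<sigma> powr (-(1/4)) * (1 - x) powr (-(1/4)))) / (1 - x)
      = 2 * \<sigma> powr (-(1/4)) * (1 - x) powr (-(5/4))" by simp
  finally show ?thesis .
qed

text \<open>
  The order 5/4 of the singularity is not integrable, but at the point \<open>u * x\<close> it splits into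
  1/2 + 3/4, the first part bounded through \<open>u * x \<le> x\<close> and the second through \<open>u * x \<le> u\<close>.
\<close>

lemma seg_avg_0_geom_diff_le:
  assumes x: "0 \<le> x" "x < 1" and \<sigma>: "\<sigma> > 0" "\<sigma> \<le> Re s" "\<sigma> \<le> Re t"
  shows "norm (seg_avg 0 (\<lambda>x. geom s x - geom t x) x) \<le> 8 * \<sigma> powr (-(1/4)) * (1 - x) powr (-(1/2))"
proof (rule norm_seg_avg_le)
  let ?c = "2 * \<sigma> powr (-(1/4)) * (1 - x) powr (-(1/2))"
  have "((\<lambda>u. (1 - u) powr (-(3/4))) has_integral 4) {0..1::real}"
    using has_integral_powr_reflect[of "3/4"] by simp
  from has_integral_mult_right[OF this, of ?c]
  show "((\<lambda>u. ?c * (1 - u) powr (-(3/4))) has_integral 8 * \<sigma> powr (-(1/4)) * (1 - x) powr (-(1/2))) {0..1}"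
    by (simp add: mult_ac)
  fix u :: real assume u: "0 < u" "u < 1"
  have ux: "u * x \<le> u" "u * x \<le> x" "0 \<le> u * x"
    using u x by (auto intro: mult_left_le mult_left_le_one_le)
  have "norm (geom s (u * x) - geom t (u * x)) \<le> 2 * \<sigma> powr (-(1/4)) * (1 - u * x) powr (-(5/4))"
    by (rule norm_geom_diff_le) (use ux x \<sigma> in linarith)+
  also have "\<dots> \<le> 2 * \<sigma> powr (-(1/4)) * ((1 - x) powr (-(1/2)) * (1 - u) powr (-(3/4)))"
  proof (rule mult_left_mono)
    have "(1 - u * x) powr (-(5/4)) = (1 - u * x) powr (-(1/2)) * (1 - u * x) powr (-(3/4))"
      by (simp add: powr_add[symmetric])
    also have "\<dots> \<le> (1 - x) powr (-(1/2)) * (1 - u) powr (-(3/4))"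
      using ux u x by (intro mult_mono powr_mono2') (linarith | simp)+
    finally show "(1 - u * x) powr (-(5/4)) \<le> (1 - x) powr (-(1/2)) * (1 - u) powr (-(3/4))" .
  qed simp
  finally show "norm (geom s (0 + u * (x - 0)) - geom t (0 + u * (x - 0))) \<le> ?c * (1 - u) powr (-(3/4))"
    by (simp add: mult_ac)
qed (use assms in \<open>auto intro!: continuous_intros continuous_on_geom\<close>)

text \<open>
  The bound does not depend on \<open>ls\<close>: once a second average towards 0 has removed the singularity,
  further averages cannot increase the supremum norm.
\<close>

lemma H_avg_diff_le:
  assumes m: "moves ks = 0 # cs @ 0 # ds" and \<sigma>: "\<sigma> > 0" "\<sigma> \<le> Re s" "\<sigma> \<le> Re t"
  shows "norm (H_avg s (ks @ ls) - H_avg t (ks @ ls)) \<le> 16 * 2 ^ length cs * \<sigma> powr (-(1/4))"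
proof -
  define g where "g = (\<lambda>x. geom s x - geom t x)"
  have cg: "continuous_on {0..1} (geom s)" "continuous_on {0..1} (geom t)"
    using \<sigma> by (auto intro!: continuous_on_geom)
  hence g: "continuous_on {0..1} g" unfolding g_def by (intro continuous_intros)
  have sets: "set cs \<subseteq> {0, 1}" "set ds \<subseteq> {0, 1}" using set_moves[of ks] m by auto
  hence sets': "set cs \<subseteq> {0..1}" "set (ds @ moves ls) \<subseteq> {0..1}"
    using set_moves_unit[of ls] by (simp_all, fastforce+)
  define h where "h = fold seg_avg cs (seg_avg 0 g)"
  have ch: "continuous_on {0..1} h"
    unfolding h_def by (intro continuous_on_fold_seg_avg continuous_on_seg_avg g sets') simp
  define C where "C = 2 ^ length cs * (8 * \<sigma> powr (-(1/4)))"
  have hb: "norm (h x) \<le> C * (1 - x) powr (-(1/2))" if "0 \<le> x" "x < 1" for x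
    unfolding h_def C_def
    by (rule fold_seg_avg_weight)
       (use that seg_avg_0_geom_diff_le[OF _ _ \<sigma>] g sets in \<open>auto simp: g_def intro!: continuous_on_seg_avg\<close>)
  have "norm (fold seg_avg (ds @ moves ls) (seg_avg 0 h) 0) \<le> 2 * C"
    by (rule norm_fold_seg_avg_le)
       (use seg_avg_0_weight[OF ch hb] ch sets' in \<open>auto intro!: continuous_on_seg_avg\<close>)
  also have "fold seg_avg (ds @ moves ls) (seg_avg 0 h) 0 = fold seg_avg (moves (ks @ ls)) g 0"
    by (simp add: m h_def)
  also have "\<dots> = H_avg s (ks @ ls) - H_avg t (ks @ ls)"
    unfolding g_def H_avg_def by (rule fold_seg_avg_diff[OF cg set_moves_unit]) simp
  finally show ?thesis by (simp add: C_def mult_ac)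
qed

text \<open>
  If the first exponent is at least 3, it begins with two averages towards 0 itself. If it is 2, it
  provides one, and any later exponent at least 2 provides another.
\<close>

lemma T_set_moves:
  assumes "k \<in> T_set"
  obtains r cs ds where "moves (map k [0..<r]) = 0 # cs @ 0 # ds"
proof (cases "k 0 \<ge> 3")
  case True
  define n where "n = k 0 - 3"
  have "k 0 - 1 = Suc (Suc n)" using True by (simp add: n_def)
  hence "moves (map k [0..<1]) = 0 # [] @ 0 # (replicate n 0 @ [1])" by simp
  thus ?thesis by (rule that)
next
  case False
  with assms have "k 0 = 2" by (auto simp: T_set_def)
  with assms obtain i where i: "i \<ge> 1" "k i \<ge> 2" by (auto simp: T_set_def)
  define n where "n = k i - 2"
  have n: "k i - 1 = Suc n" using i by (simp add: n_def)
  have "[0..<Suc i] = 0 # [1..<i] @ [i]" using i by (simp add: upt_conv_Cons)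
  hence "moves (map k [0..<Suc i]) = 0 # (1 # moves (map k [1..<i])) @ 0 # (replicate n 0 @ [1])"
    using n \<open>k 0 = 2\<close> by simp
  thus ?thesis by (rule that)
qed

text \<open>
  All terms are nonnegative, so the unconditional sum over all tuples is the limit of the partial
  sums along the exhaustion by tuples bounded by \<open>n\<close>.
\<close>

lemma zeta_star_eqI:
  assumes "(\<lambda>n. H_fin n ks) \<longlonglongrightarrow> L"
  shows "complex_of_real (zeta_star ks) = L"
proof -
  define w where "w = (\<lambda>ms. 1 / (\<Prod>i<length ks. real (ms ! i) ^ (ks ! i)))"
  define A where "A = (\<lambda>n. bounded_tuples (length ks) n)"
  define S where "S = (\<lambda>n. sum w (A n))"
  have w0: "w ms \<ge> 0" for ms by (simp add: w_def prod_nonneg)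
  have fin: "finite (A n)" for n unfolding A_def by (rule finite_bounded_tuples)
  have HS: "H_fin n ks = of_real (S n)" for n by (simp add: H_fin_def S_def w_def A_def)
  have "(\<lambda>n. Re (H_fin n ks)) \<longlonglongrightarrow> Re L" by (rule tendsto_Re[OF assms])
  hence S: "S \<longlonglongrightarrow> Re L" by (simp add: HS)
  have "(\<lambda>n. Im (H_fin n ks)) \<longlonglongrightarrow> Im L" by (rule tendsto_Im[OF assms])
  hence "Im L = 0" by (simp add: HS LIMSEQ_const_iff)
  have mono: "incseq S"
    unfolding S_def using w0 fin
    by (intro incseq_SucI sum_mono2) (auto simp: A_def)
  have ex: "\<exists>n. F \<subseteq> A n" if F: "finite F" "F \<subseteq> noninc_tuples (length ks)" for F
  proof
    show "F \<subseteq> A (Max (insert 0 (\<Union>(set ` F))))"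
      using F by (auto simp: A_def intro!: Max_ge)
  qed
  have up: "sum w F \<le> Re L" if F: "finite F" "F \<subseteq> noninc_tuples (length ks)" for F
  proof -
    from ex[OF F] obtain n where "F \<subseteq> A n" ..
    hence "sum w F \<le> S n" unfolding S_def using w0 fin by (intro sum_mono2) auto
    also have "S n \<le> Re L" by (rule incseq_le[OF mono S])
    finally show ?thesis .
  qed
  have "(w has_sum (Re L)) (noninc_tuples (length ks))"
    unfolding has_sum_def
  proof (rule order_tendstoI)
    fix a assume "a < Re L"
    then obtain n where n: "a < S n"
      using order_tendstoD(1)[OF S] by (auto simp: eventually_sequentially)
    have "\<forall>F. finite F \<and> A n \<subseteq> F \<and> F \<subseteq> noninc_tuples (length ks) \<longrightarrow> a < sum w F"
    proof (intro allI impI)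
      fix F assume F: "finite F \<and> A n \<subseteq> F \<and> F \<subseteq> noninc_tuples (length ks)"
      hence "S n \<le> sum w F" unfolding S_def using w0 by (intro sum_mono2) auto
      with n show "a < sum w F" by simp
    qed
    thus "eventually (\<lambda>F. a < sum w F) (finite_subsets_at_top (noninc_tuples (length ks)))"
      unfolding eventually_finite_subsets_at_top using fin[of n] by (intro exI[of _ "A n"]) (auto simp: A_def)
  next
    fix a assume "Re L < a"
    with up show "eventually (\<lambda>F. sum w F < a) (finite_subsets_at_top (noninc_tuples (length ks)))"
      unfolding eventually_finite_subsets_at_top by (intro exI[of _ "{}"]) fastforce
  qed
  hence "zeta_star ks = Re L" by (simp add: zeta_star_def w_def infsumI)
  with \<open>Im L = 0\<close> show ?thesis by (simp add: complex_eq_iff)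
qed

text \<open>
  At integer points the hypothesis makes the finite sums a Cauchy sequence, so the series for
  \<open>zeta_star\<close> converges; the bound follows by letting \<open>t\<close> run through the integers.
\<close>

lemma H_avg_zeta_star_le:
  assumes ks: "\<forall>k\<in>set ks. 1 \<le> k"
    and C: "\<And>\<sigma> s t. \<sigma> > 0 \<Longrightarrow> \<sigma> \<le> Re s \<Longrightarrow> \<sigma> \<le> Re t \<Longrightarrow>
      norm (H_avg s ks - H_avg t ks) \<le> C * \<sigma> powr (-(1/4))"
    and s: "Re s > 0"
  shows "norm (H_avg s ks - of_real (zeta_star ks)) \<le> C * Re s powr (-(1/4))"
proof -
  have lim0: "(\<lambda>n. C * real n powr (-(1/4))) \<longlonglongrightarrow> 0"
  proof -
    have "(\<lambda>n. real n powr (-(1/4))) \<longlonglongrightarrow> 0"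
      by (rule tendsto_neg_powr) (auto intro: filterlim_real_sequentially)
    from tendsto_mult_left[OF this, of C] show ?thesis by simp
  qed
  have "Cauchy (\<lambda>n. H_avg (of_nat n) ks)"
  proof (rule metric_CauchyI)
    fix e :: real assume "e > 0"
    from order_tendstoD(2)[OF lim0 this] eventually_ge_at_top[of 1]
    have "eventually (\<lambda>n. C * real n powr (-(1/4)) < e \<and> 1 \<le> n) sequentially"
      by eventually_elim simp
    then obtain N where N: "C * real N powr (-(1/4)) < e" "1 \<le> N"
      by (auto simp: eventually_sequentially)
    have "dist (H_avg (of_nat m) ks) (H_avg (of_nat n) ks) < e" if "m \<ge> N" "n \<ge> N" for m n
      using C[of "real N" "of_nat m" "of_nat n"] N that by (auto simp: dist_norm)
    thus "\<exists>M. \<forall>m\<ge>M. \<forall>n\<ge>M. dist (H_avg (of_nat m) ks) (H_avg (of_nat n) ks) < e" by blast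
  qed
  then obtain L where L: "(\<lambda>n. H_avg (of_nat n) ks) \<longlonglongrightarrow> L"
    by (auto simp: Cauchy_convergent_iff convergent_def)
  have "eventually (\<lambda>n. H_avg (of_nat n) ks = H_fin n ks) sequentially"
    using H_avg_nat[OF ks] by (intro eventually_sequentiallyI[of 1])
  with L have "(\<lambda>n. H_fin n ks) \<longlonglongrightarrow> L" by (simp add: filterlim_cong)
  hence z: "of_real (zeta_star ks) = L" by (rule zeta_star_eqI)
  show ?thesis
  proof (rule Lim_bounded)
    show "(\<lambda>n. norm (H_avg s ks - H_avg (of_nat n) ks)) \<longlonglongrightarrow> norm (H_avg s ks - of_real (zeta_star ks))"
      unfolding z by (intro tendsto_intros L)
    show "\<forall>n\<ge>nat \<lceil>Re s\<rceil>. norm (H_avg s ks - H_avg (of_nat n) ks) \<le> C * Re s powr (-(1/4))"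
      using s by (intro allI impI C) (auto simp: nat_le_iff ceiling_le_iff)
  qed
qed

text \<open>
  The estimate of \<open>H_avg_zeta_star_le\<close> is uniform in \<open>r\<close>, so it survives the limit; it also
  transfers the Cauchy property in \<open>r\<close> from \<open>H_avg\<close> at one large real point to \<open>zeta_star\<close>.
\<close>

lemma frak_h_eta_map_le:
  assumes k: "k \<in> T_set"
  obtains C where "\<And>s. Re s > 0 \<Longrightarrow>
    norm (frak_h s k - of_real (eta_map k)) \<le> C * Re s powr (-(1/4))"
proof -
  from T_set_moves[OF k] obtain r0 cs ds where m: "moves (map k [0..<r0]) = 0 # cs @ 0 # ds" .
  define C :: real where "C = 16 * 2 ^ length cs"
  define z where "z = (\<lambda>r. zeta_star (map k [0..<r]))"
  have pos: "\<forall>i\<in>set (map k [0..<r]). 1 \<le> i" for r using k by (auto simp: T_set_def T_hat_def)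
  have diff: "norm (H_avg s (map k [0..<r]) - of_real (z r)) \<le> C * Re s powr (-(1/4))"
    if "r \<ge> r0" "Re s > 0" for s r
    unfolding z_def
  proof (rule H_avg_zeta_star_le[OF pos _ that(2)])
    fix \<sigma> :: real and s t :: complex assume "\<sigma> > 0" "\<sigma> \<le> Re s" "\<sigma> \<le> Re t"
    from H_avg_diff_le[OF m this, of "map k [r0..<r]"]
    show "norm (H_avg s (map k [0..<r]) - H_avg t (map k [0..<r])) \<le> C * \<sigma> powr (-(1/4))"
      using map_upt_split[OF that(1), of k] by (simp add: C_def)
  qed
  have conv: "(\<lambda>r. H_avg s (map k [0..<r])) \<longlonglongrightarrow> frak_h s k" if "Re s > 0" for s
    using fold_seg_avg_moves_convergent[OF continuous_on_geom[OF that], of k]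
      H_star_eq_H_avg[OF that pos]
    by (simp add: convergent_LIMSEQ_iff frak_h_def H_avg_def)
  have lim0: "((\<lambda>\<sigma>. C * \<sigma> powr (-(1/4))) \<longlongrightarrow> 0) at_top"
  proof -
    have "((\<lambda>\<sigma>. \<sigma> powr (-(1/4))) \<longlongrightarrow> (0::real)) at_top"
      by (rule tendsto_neg_powr) (auto intro: filterlim_ident)
    from tendsto_mult_left[OF this, of C] show ?thesis by simp
  qed
  have "Cauchy z"
  proof (rule metric_CauchyI)
    fix e :: real assume e: "e > 0"
    hence "e / 3 > 0" by simp
    from order_tendstoD(2)[OF lim0 this] eventually_gt_at_top[of 0]
    have "eventually (\<lambda>\<sigma>. C * \<sigma> powr (-(1/4)) < e / 3 \<and> 0 < \<sigma>) at_top"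
      by eventually_elim simp
    then obtain \<sigma> where \<sigma>: "C * \<sigma> powr (-(1/4)) < e / 3" "0 < \<sigma>"
      using eventually_happens'[OF trivial_limit_at_top_linorder] by blast
    let ?h = "\<lambda>r. H_avg (of_real \<sigma>) (map k [0..<r])"
    have "Cauchy ?h" using conv[of "of_real \<sigma>"] \<sigma> by (intro LIMSEQ_imp_Cauchy) auto
    from metric_CauchyD[OF this \<open>e / 3 > 0\<close>] obtain N where
      N: "\<And>m n. m \<ge> N \<Longrightarrow> n \<ge> N \<Longrightarrow> dist (?h m) (?h n) < e / 3" by blast
    show "\<exists>M. \<forall>m\<ge>M. \<forall>n\<ge>M. dist (z m) (z n) < e"
    proof (intro exI allI impI)
      fix m n assume mn: "max N r0 \<le> m" "max N r0 \<le> n"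
      have "dist (of_real (z m)) (of_real (z n) :: complex)
          \<le> dist (of_real (z m)) (?h m) + dist (?h m) (?h n) + dist (?h n) (of_real (z n))"
        using dist_triangle[of "of_real (z m)" "of_real (z n)" "?h m"]
          dist_triangle[of "?h m" "of_real (z n)" "?h n"] by linarith
      also have "\<dots> < e / 3 + e / 3 + e / 3"
        using N[of m n] diff[of m "of_real \<sigma>"] diff[of n "of_real \<sigma>"] mn \<sigma>
        by (simp add: dist_norm norm_minus_commute)
      finally show "dist (z m) (z n) < e" by (simp add: dist_of_real)
    qed
  qed
  hence "convergent z" by (simp add: Cauchy_convergent_iff)
  hence z: "z \<longlonglongrightarrow> eta_map k" by (simp add: convergent_LIMSEQ_iff eta_map_def z_def)
  show ?thesis
  proof
    fix s :: complex assume s: "Re s > 0"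
    show "norm (frak_h s k - of_real (eta_map k)) \<le> C * Re s powr (-(1/4))"
    proof (rule Lim_bounded)
      show "(\<lambda>r. norm (H_avg s (map k [0..<r]) - of_real (z r))) \<longlonglongrightarrow> norm (frak_h s k - of_real (eta_map k))"
        by (intro tendsto_intros conv s z)
      show "\<forall>r\<ge>r0. norm (H_avg s (map k [0..<r]) - of_real (z r)) \<le> C * Re s powr (-(1/4))"
        using diff s by blast
    qed
  qed
qed

lemma frak_h_tendsto_eta_map:
  assumes k: "k \<in> T_set"
  shows "((\<lambda>s. frak_h s k) \<longlongrightarrow> complex_of_real (eta_map k)) (filtercomap Re at_top)"
proof -
  from frak_h_eta_map_le[OF k] obtain C where
    C: "\<And>s. Re s > 0 \<Longrightarrow> norm (frak_h s k - of_real (eta_map k)) \<le> C * Re s powr (-(1/4))" by blast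
  have Re: "filterlim Re at_top (filtercomap Re at_top)" by (rule filterlim_filtercomap)
  have "((\<lambda>s. Re s powr (-(1/4))) \<longlongrightarrow> 0) (filtercomap Re at_top)"
    by (rule tendsto_neg_powr[OF _ Re]) simp
  from tendsto_mult_left[OF this, of C]
  have "((\<lambda>s. C * Re s powr (-(1/4))) \<longlongrightarrow> 0) (filtercomap Re at_top)" by simp
  moreover have "eventually (\<lambda>s. Re s > 0) (filtercomap Re at_top)"
    using Re by (simp add: filterlim_at_top_dense)
  hence "eventually (\<lambda>s. norm (frak_h s k - of_real (eta_map k)) \<le> C * Re s powr (-(1/4)))
      (filtercomap Re at_top)"
    by eventually_elim (rule C)
  ultimately have "((\<lambda>s. frak_h s k - of_real (eta_map k)) \<longlongrightarrow> 0) (filtercomap Re at_top)"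
    by (rule Lim_null_comparison[rotated])
  thus ?thesis by (simp add: LIM_zero_iff)
qed

theorem theorem1p4:
  shows "(\<forall>s::complex. Re s > 0 \<longrightarrow>
            (\<forall>k\<in>T_hat. convergent (\<lambda>r. H_star s (map k [0..<r])))) \<and>
         (\<forall>s::real. s > 1 \<longrightarrow>
            bij_betw (frak_h (complex_of_real s)) T_hat (complex_of_real ` {1<..s})) \<and>
         (\<forall>k\<in>T_set. \<forall>B::real. B > 0 \<longrightarrow>
            ((\<lambda>s. frak_h s k) \<longlongrightarrow> complex_of_real (eta_map k))
              (inf (filtercomap Re at_top) (principal {s. \<bar>Im s\<bar> \<le> B})))"
proof (intro conjI allI ballI impI)
  fix s :: complex and k assume s: "Re s > 0" and k: "k \<in> T_hat"
  have "H_star s (map k [0..<r]) = H_avg s (map k [0..<r])" for r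
    using k by (intro H_star_eq_H_avg s) (auto simp: T_hat_def)
  thus "convergent (\<lambda>r. H_star s (map k [0..<r]))"
    using fold_seg_avg_moves_convergent[OF continuous_on_geom[OF s]] by (simp add: H_avg_def)
next
  fix s :: real assume "s > 1"
  thus "bij_betw (frak_h (complex_of_real s)) T_hat (complex_of_real ` {1<..s})"
    by (rule bij_betw_frak_h)
next
  fix k B assume "k \<in> T_set"
  thus "((\<lambda>s. frak_h s k) \<longlongrightarrow> complex_of_real (eta_map k))
      (inf (filtercomap Re at_top) (principal {s. \<bar>Im s\<bar> \<le> B}))"
    by (intro tendsto_mono[OF inf_le1] frak_h_tendsto_eta_map)
qed

end
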